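(* Let $\mathcal{G}=(\mathcal{V},\mathcal{E})$ be a finite connected undirected graph, $\mathcal{N}$ a set of $n$ agents with pairwise distinct start vertices $s:\mathcal{N}\to\mathcal{V}$, and $\mathcal{T}\subset\mathcal{V}$ a set of $n$ target (goal) vertices. Let the communication range be $k\ge 2$ edges, with chain communication allowed. Suppose that all agents synchronously execute the decentralized algorithm TP-SWAP (defined in the context), starting from arbitrary individually selected initial targets in $\mathcal{T}$ (several agents may select the same target) and pairwise distinct priorities in $\mathbb{N}$. Then there exists a finite time $t$ at which all goals are achieved by the agents, i.e. at time $t$ every vertex of $\mathcal{T}$ is occupied by an agent.
   Context: Setting. Time is discrete. At each timestep every agent either moves to an adjacent vertex or waits at its current vertex. $dist$ denotes shortest-path length in $\mathcal{G}$. Every agent knows $\mathcal{G}$ and $\mathcal{T}$. Two agents communicate directly if their current vertices are at distance at most $k$. With chain communication, an agent exchanges information (instantaneously and without errors) with all agents in its connected component of the direct-communication relation. This component, which includes the agent itself, is its current subgroup $NH$. $\mathrm{nextVertex}(v,\tau)$ is a fixed deterministic function, common to all agents. For $v\ne\tau$ it returns a neighbour $v'$ of $v$ lying on a shortest path from $v$ to $\tau$, so $dist(v',\tau)=dist(v,\tau)-1$. Ties are broken by a fixed deterministic rule common to all agents. State of each agent $i$: its current vertex (initially $s(i)$), its current target $\tau^i\in\mathcal{T}$, its current priority $pr^i\in\mathbb{N}$, and a target-priority table $TP^i:\mathcal{T}\to\mathbb{N}\cup\{-\infty\}$. Initially $\tau^i$ is any element of $\mathcal{T}$ chosen by agent $i$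 itself, the priorities $pr^i$ are pairwise distinct, $TP^i[\tau^i]=pr^i$, and $TP^i[\tau']=-\infty$ for all $\tau'\neq\tau^i$. TP-SWAP. At each timestep, each agent $i$ does the following (all agents simultaneously): 1. It determines its subgroup $NH$ and collects, for all $j\in NH$, the current vertex $V[j]$, the target $TA[j]$ and the priority $PR[j]$. It sets $TP[\tau]:=\max_{j\in NH}TP^j[\tau]$ for all $\tau\in\mathcal{T}$. 2. It runs the procedure TP-UPDATE on $(NH,V,TA,PR,TP)$. All members of a subgroup have the same input and hence compute the same result. (a) Sort $NH$ by decreasing priority $PR$. This order is fixed for (b) and (c). (b) For each $j\in NH$ in this order: if $TP[TA[j]]>PR[j]$, then set $TA[j]$ to be a target $\tau'\in\mathcal{T}$ closest (in $dist$) to $V[j]$ among those with $TP[\tau']\le PR[j]$, and then set $TP[TA[j]]:=PR[j]$. (c) For each $j\in NH$ in this order, using the current (possibly already updated) tables: if $V[j]=TA[j]$, go on to the next agent. Otherwise let $v=\mathrm{nextVertex}(V[j],TA[j])$. - If no $l\in NH$ has $V[l]=v$, set $V[j]:=v$. - If some $l\in NH$ has $V[l]=v$ and $v=TA[l]$, swap $TA[j]$ with $TA[l]$ and swap $PR[j]$ with $PR[l]$ ($V[j]$ is unchanged). - If some $l\in NH$ has $V[l]=v$ and $v\ne TA[l]$, check whether $j$ is in a deadlock. A deadlock is a cyclic sequence of distinct agents $a_1=j,a_2,\dots,a_m$ in $NH$ ($m\ge2$) such that $V[a_q]\neq TA[a_q]$ and $\mathrm{nextVertex}(V[a_q],TA[a_q])=V[a_{q+1}]$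 for all $q$, with $a_{m+1}:=a_1$. If so, rotate targets and priorities along the cycle: simultaneously for all $q$, agent $a_{q+1}$ receives the old target and old priority of $a_q$. If there is no deadlock, nothing is done. In either case $V[j]$ is unchanged. 3. Agent $i$ sets its target to $TA[i]$, its priority to $PR[i]$ and its table $TP^i$ to $TP$, all as output by TP-UPDATE, and moves to the vertex $V[i]$ output by TP-UPDATE (waiting if it equals its current vertex). *)

theory Defs
  imports "Graph_Theory.Graph_Theory" "HOL-Library.Option_ord" "HOL-Library.FuncSet"
begin

text \<open>
  A finite undirected graph is a symmetric, loop-free, finite digraph without parallel arcs
  (locale \<^locale>\<open>graph\<close>). An edge is thus a pair of opposite arcs. The length of a path is its
  number of arcs; the value is junk if there is no path.
\<close>

definition gdist :: "('v, 'e) pre_digraph \<Rightarrow> 'v \<Rightarrow> 'v \<Rightarrow> nat" where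
  "gdist G u v = (LEAST n. \<exists>p. pre_digraph.apath G u p v \<and> length p = n)"

definition next_vertex_rule :: "('v, 'e) pre_digraph \<Rightarrow> ('v \<Rightarrow> 'v \<Rightarrow> 'v) \<Rightarrow> bool" where
  "next_vertex_rule G nextVertex \<longleftrightarrow>
     (\<forall>v \<in> verts G. \<forall>\<tau> \<in> verts G. v \<noteq> \<tau> \<longrightarrow>
        v \<rightarrow>\<^bsub>G\<^esub> nextVertex v \<tau> \<and> gdist G (nextVertex v \<tau>) \<tau> + 1 = gdist G v \<tau>)"

text \<open>
  The global state. In a target-priority table, \<^term>\<open>None\<close> stands for minus infinity: the order
  on \<^typ>\<open>nat option\<close> has \<^term>\<open>None\<close> as its least element. Only the values at agents (and, for
  \<open>tptab\<close>, at targets) are meaningful.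
\<close>

record ('a, 'v) state =
  pos :: "'a \<Rightarrow> 'v"
  targ :: "'a \<Rightarrow> 'v"
  prio :: "'a \<Rightarrow> nat"
  tptab :: "'a \<Rightarrow> 'v \<Rightarrow> nat option"

definition init_state :: "('a \<Rightarrow> 'v) \<Rightarrow> ('a \<Rightarrow> 'v) \<Rightarrow> ('a \<Rightarrow> nat) \<Rightarrow> ('a, 'v) state" where
  "init_state s \<tau>0 pr0 =
     \<lparr>pos = s, targ = \<tau>0, prio = pr0, tptab = (\<lambda>i. (\<lambda>_. None)(\<tau>0 i := Some (pr0 i)))\<rparr>"

definition direct_comm ::
  "('v, 'e) pre_digraph \<Rightarrow> 'a set \<Rightarrow> nat \<Rightarrow> ('a, 'v) state \<Rightarrow> 'a rel" where
  "direct_comm G N k \<sigma> = {(i, j). i \<in> N \<and> j \<in> N \<and> gdist G (pos \<sigma> i) (pos \<sigma> j) \<le> k}"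

definition subgroup_of ::
  "('v, 'e) pre_digraph \<Rightarrow> 'a set \<Rightarrow> nat \<Rightarrow> ('a, 'v) state \<Rightarrow> 'a \<Rightarrow> 'a set" where
  "subgroup_of G N k \<sigma> i = {j \<in> N. (i, j) \<in> (direct_comm G N k \<sigma>)\<^sup>*}"

text \<open>
  The data on which one subgroup runs TP-UPDATE. They are restricted to the subgroup, so that an
  update can depend only on what the subgroup has collected.
\<close>

record ('a, 'v) tables =
  NH :: "'a set"
  V :: "'a \<Rightarrow> 'v"
  TA :: "'a \<Rightarrow> 'v"
  PR :: "'a \<Rightarrow> nat"
  TP :: "'v \<Rightarrow> nat option"

definition collect ::
  "('v, 'e) pre_digraph \<Rightarrow> 'a set \<Rightarrow> nat \<Rightarrow> ('a, 'v) state \<Rightarrow> 'a \<Rightarrow> ('a, 'v) tables" where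
  "collect G N k \<sigma> i =
     (let H = subgroup_of G N k \<sigma> i in
      \<lparr>NH = H, V = restrict (pos \<sigma>) H, TA = restrict (targ \<sigma>) H, PR = restrict (prio \<sigma>) H,
       TP = (\<lambda>\<tau>. Max ((\<lambda>j. tptab \<sigma> j \<tau>) ` H))\<rparr>)"

definition candidates :: "'v set \<Rightarrow> ('a, 'v) tables \<Rightarrow> 'a \<Rightarrow> 'v set" where
  "candidates T D j = {\<tau> \<in> T. TP D \<tau> \<le> Some (PR D j)}"

text \<open>
  Ties between closest targets may be broken by any deterministic rule on the common data of the
  subgroup. Nothing is assumed about the rule if there is no candidate.
\<close>

definition closest_target_rule ::
  "('v, 'e) pre_digraph \<Rightarrow> 'v set \<Rightarrow> (('a, 'v) tables \<Rightarrow> 'a \<Rightarrow> 'v) \<Rightarrow> bool" where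
  "closest_target_rule G T closest \<longleftrightarrow>
     (\<forall>D. \<forall>j \<in> NH D. candidates T D j \<noteq> {} \<longrightarrow>
        is_arg_min (gdist G (V D j)) (\<lambda>\<tau>. \<tau> \<in> candidates T D j) (closest D j))"

definition reassign ::
  "(('a, 'v) tables \<Rightarrow> 'a \<Rightarrow> 'v) \<Rightarrow> 'a \<Rightarrow> ('a, 'v) tables \<Rightarrow> ('a, 'v) tables" where
  "reassign closest j D =
     (if TP D (TA D j) > Some (PR D j) then
        let \<tau> = closest D j in
        D\<lparr>TA := (TA D)(j := \<tau>), TP := (TP D)(\<tau> := Some (PR D j))\<rparr>
      else D)"

definition deadlock :: "('v \<Rightarrow> 'v \<Rightarrow> 'v) \<Rightarrow> ('a, 'v) tables \<Rightarrow> 'a \<Rightarrow> 'a list \<Rightarrow> bool" where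
  "deadlock nextVertex D j c \<longleftrightarrow>
     length c \<ge> 2 \<and> distinct c \<and> set c \<subseteq> NH D \<and> c ! 0 = j \<and>
     (\<forall>q < length c. V D (c ! q) \<noteq> TA D (c ! q) \<and>
        nextVertex (V D (c ! q)) (TA D (c ! q)) = V D (c ! (Suc q mod length c)))"

text \<open>
  Each agent in the cycle receives the old value of its predecessor, the first agent that of the
  last one: \<open>zip (rotate1 c) c\<close> pairs every agent with its predecessor.
\<close>

definition rotate_along :: "'a list \<Rightarrow> ('a \<Rightarrow> 'b) \<Rightarrow> 'a \<Rightarrow> 'b" where
  "rotate_along c f i = (case map_of (zip (rotate1 c) c) i of None \<Rightarrow> f i | Some p \<Rightarrow> f p)"

text \<open>
  The choices below are harmless: agents occupy distinct vertices in every reachable state, so the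
  occupant of a vertex, and hence the deadlock cycle starting at a given agent, is unique.
\<close>

definition advance ::
  "('v \<Rightarrow> 'v \<Rightarrow> 'v) \<Rightarrow> 'a \<Rightarrow> ('a, 'v) tables \<Rightarrow> ('a, 'v) tables" where
  "advance nextVertex j D =
     (if V D j = TA D j then D
      else
        let v = nextVertex (V D j) (TA D j) in
        if \<not> (\<exists>l \<in> NH D. V D l = v) then D\<lparr>V := (V D)(j := v)\<rparr>
        else if \<exists>l \<in> NH D. V D l = v \<and> v = TA D l then
          let l = (SOME l. l \<in> NH D \<and> V D l = v \<and> v = TA D l) in
          D\<lparr>TA := (TA D)(j := TA D l, l := TA D j), PR := (PR D)(j := PR D l, l := PR D j)\<rparr>
        else if \<exists>c. deadlock nextVertex D j c then
          let c = (SOME c. deadlock nextVertex D j c) in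
          D\<lparr>TA := rotate_along c (TA D), PR := rotate_along c (PR D)\<rparr>
        else D)"

definition tp_update ::
  "('v \<Rightarrow> 'v \<Rightarrow> 'v) \<Rightarrow> (('a, 'v) tables \<Rightarrow> 'a \<Rightarrow> 'v) \<Rightarrow> ('a, 'v) tables \<Rightarrow> ('a, 'v) tables" where
  "tp_update nextVertex closest D =
     (let order = rev (sorted_key_list_of_set (PR D) (NH D))
      in fold (advance nextVertex) order (fold (reassign closest) order D))"

definition tp_swap_step ::
  "('v, 'e) pre_digraph \<Rightarrow> 'a set \<Rightarrow> nat \<Rightarrow> ('v \<Rightarrow> 'v \<Rightarrow> 'v) \<Rightarrow> (('a, 'v) tables \<Rightarrow> 'a \<Rightarrow> 'v) \<Rightarrow>
   ('a, 'v) state \<Rightarrow> ('a, 'v) state" where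
  "tp_swap_step G N k nextVertex closest \<sigma> =
     (let out = (\<lambda>i. tp_update nextVertex closest (collect G N k \<sigma> i)) in
      \<lparr>pos = (\<lambda>i. V (out i) i), targ = (\<lambda>i. TA (out i) i), prio = (\<lambda>i. PR (out i) i),
       tptab = (\<lambda>i. TP (out i))\<rparr>)"

text \<open>The state at time \<open>t\<close> of the run that starts in the state \<open>\<sigma>\<close> at time 0.\<close>

definition tp_swap_run ::
  "('v, 'e) pre_digraph \<Rightarrow> 'a set \<Rightarrow> nat \<Rightarrow> ('v \<Rightarrow> 'v \<Rightarrow> 'v) \<Rightarrow> (('a, 'v) tables \<Rightarrow> 'a \<Rightarrow> 'v) \<Rightarrow>
   ('a, 'v) state \<Rightarrow> nat \<Rightarrow> ('a, 'v) state" where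
  "tp_swap_run G N k nextVertex closest \<sigma> t = (tp_swap_step G N k nextVertex closest ^^ t) \<sigma>"

end

theory Submission
  imports Defs
begin

text \<open>
  A pair of a target and its priority is a token; swaps and rotations only hand tokens around. The
  entries of the target-priority tables never decrease, so they are constant from some time on, and
  then no token changes its target any more. From that time on, give a token at distance \<open>d\<close> from its
  target the weight \<open>2 * d\<close>, but 1 if \<open>d = 0\<close>. Moves, swaps and rotations all decrease the total
  weight, and if nothing happens in a step, then every agent is at its target: otherwise following
  the next vertices would lead to a deadlock. A range of at least 2 ensures that two agents entering
  the same vertex belong to the same subgroup, so that agents never collide.
\<close>

subsection \<open>Distances\<close>

text \<open>Separate subgroups have different tables: a target may be claimed by tokens in several
  subgroups, and a priority may stand at targets that its token has left. If a merge left one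
  priority at two targets, the count that guarantees a candidate to every agent giving up its target
  would break. Outdated records cannot be excluded, so they are only required to be beaten by a
  larger entry somewhere, which the maximum taken in a merge brings to bear
  (\<open>sound_collect\<close>).

  Constant tables freeze the targets because a reassignment writes a priority that stands nowhere in
  the current table, so the overwritten entry rises strictly. A reassignment may increase the total
  weight, which is therefore compared only after the tables, lexicographically. Double claims
  between subgroups resolve themselves at the end: agents never share a vertex, so once all of them
  are at their targets, the targets are distinct.\<close>

context graph
begin

text \<open>\<open>gdist\<close> minimises over paths, whereas walks can be reversed and
  concatenated freely. Cutting out cycles only shortens a walk, so every walk bounds the
  distance.\<close>

lemma awalk_imp_shorter_apath:
  assumes "awalk u p v"
  obtains q where "apath u q v" "length q \<le> length p"
proof -
  have "\<exists>q. apath u q v \<and> length q \<le> length p"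
    using assms
  proof (induct rule: awalk_to_apath_induct)
    case (path p)
    then show ?case by (auto simp: apath_def)
  next
    case (decomp p q r s)
    then have "p = q @ r @ s" by (auto elim!: awalk_cyc_decompE)
    with decomp show ?case by fastforce
  qed
  with that show thesis by blast
qed

lemma gdist_le_awalk:
  assumes "awalk u p v"
  shows "gdist G u v \<le> length p"
proof -
  obtain q where "apath u q v" "length q \<le> length p"
    using awalk_imp_shorter_apath[OF assms] .
  then have "gdist G u v \<le> length q" unfolding gdist_def by (intro Least_le) blast
  with \<open>length q \<le> length p\<close> show ?thesis by simp
qed

lemma awalk_rev:
  assumes "awalk u p v"
  shows "\<exists>q. awalk v q u \<and> length q = length p"
  using assms
proof (induction p arbitrary: u)
  case Nil
  then show ?case by (auto simp: awalk_Nil_iff)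
next
  case (Cons e p)
  then have e: "e \<in> arcs G" "tail G e = u" and p: "awalk (head G e) p v"
    by (auto simp: awalk_Cons_iff)
  from Cons.IH[OF p] obtain q where q: "awalk v q (head G e)" "length q = length p" by blast
  from e(1) sym_arcs obtain e' where "e' \<in> arcs G" "tail G e' = head G e" "head G e' = u"
    unfolding symmetric_conv using e(2) by metis
  then have "awalk (head G e) [e'] u" using arc_implies_awalk by metis
  with q have "awalk v (q @ [e']) u \<and> length (q @ [e']) = length (e # p)"
    by (auto intro: awalk_appendI)
  then show ?case by blast
qed

lemma gdist_self: "v \<in> verts G \<Longrightarrow> gdist G v v = 0"
  using gdist_le_awalk[of v "[]" v] by (simp add: awalk_Nil_iff)

lemma gdist_common_neighbour:
  assumes "u \<rightarrow>\<^bsub>G\<^esub> v" "w \<rightarrow>\<^bsub>G\<^esub> v"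
  shows "gdist G u w \<le> 2"
proof -
  from assms sym_arcs have "v \<rightarrow>\<^bsub>G\<^esub> w" using arcs_ends_symmetric by metis
  with assms obtain e f where "e \<in> arcs G" "tail G e = u" "head G e = v"
    and "f \<in> arcs G" "tail G f = v" "head G f = w"
    by (auto simp: arcs_ends_conv)
  then have "awalk u [e, f] w" by (auto simp: awalk_simps)
  from gdist_le_awalk[OF this] show ?thesis by simp
qed

lemma gdist_adjacent:
  assumes "u \<rightarrow>\<^bsub>G\<^esub> v"
  shows "gdist G u v \<le> 1"
proof -
  from assms obtain e where "e \<in> arcs G" "tail G e = u" "head G e = v"
    by (auto simp: arcs_ends_conv)
  then have "awalk u [e] v" by (auto simp: awalk_simps)
  from gdist_le_awalk[OF this] show ?thesis by simp
qed

end

locale connected_graph = graph +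
  assumes connected: "connected G"
begin

lemma shortest_apath:
  assumes "u \<in> verts G" "v \<in> verts G"
  obtains p where "apath u p v" "length p = gdist G u v"
proof -
  have "strongly_connected G"
    using symmetric_connected_imp_strongly_connected sym_arcs connected by blast
  with assms have "u \<rightarrow>\<^sup>* v" by (auto elim!: strongly_connectedE)
  then obtain p where "apath u p v" using reachable_apath by blast
  then have "\<exists>q. apath u q v \<and> length q = gdist G u v"
    unfolding gdist_def by (rule_tac LeastI_ex) blast
  with that show thesis by blast
qed

lemma gdist_eq_0_iff:
  assumes "u \<in> verts G" "v \<in> verts G"
  shows "gdist G u v = 0 \<longleftrightarrow> u = v"
  using shortest_apath[OF assms] gdist_self assms by (metis apath_Nil_iff length_0_conv)

lemma gdist_commute:
  assumes "u \<in> verts G" "v \<in> verts G"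
  shows "gdist G u v = gdist G v u"
proof -
  have "gdist G x y \<le> gdist G y x" if "x \<in> verts G" "y \<in> verts G" for x y
    using shortest_apath[OF that(2,1)] awalk_rev gdist_le_awalk by (metis awalkI_apath)
  with assms show ?thesis by (simp add: order_antisym)
qed

end

subsection \<open>Lists, cycles and orbits\<close>

lemma Max_image_cases:
  assumes "finite H" "i \<in> H"
  obtains j where "j \<in> H" "Max (f ` H) = f j" "\<And>l. l \<in> H \<Longrightarrow> f l \<le> f j"
proof -
  have "Max (f ` H) \<in> f ` H" using assms by (intro Max_in) auto
  then obtain j where j: "j \<in> H" "Max (f ` H) = f j" by blast
  moreover have "f l \<le> f j" if "l \<in> H" for l
    using Max_ge[of "f ` H" "f l"] that assms(1) j(2) by simp
  ultimately show thesis using that by blast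
qed

lemma (in linorder) rev_sorted_key_list_of_set:
  fixes f :: "'b \<Rightarrow> 'a"
  assumes "finite H" "inj_on f H"
  shows "set (rev (sorted_key_list_of_set f H)) = H"
    and "sorted_wrt (\<lambda>i j. f j < f i) (rev (sorted_key_list_of_set f H))"
proof -
  interpret folding_insort_key "(\<le>)" "(<)" H f
    using assms(2) by unfold_locales
  show "set (rev (sorted_key_list_of_set f H)) = H"
    using set_sorted_key_list_of_set[OF subset_refl assms(1)] by simp
  show "sorted_wrt (\<lambda>i j. f j < f i) (rev (sorted_key_list_of_set f H))"
    using strict_sorted_key_list_of_set[of H] by (simp add: sorted_wrt_rev sorted_wrt_map)
qed

lemma rotate_along_nth:
  assumes "distinct c" "q < length c"
  shows "rotate_along c f (c ! (Suc q mod length c)) = f (c ! q)"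
proof -
  have "map_of (zip (rotate1 c) c) (rotate1 c ! q) = Some (c ! q)"
    using assms by (intro map_of_zip_nth) auto
  then show ?thesis
    using assms by (simp add: rotate_along_def nth_rotate1)
qed

lemma rotate_along_outside:
  assumes "i \<notin> set c"
  shows "rotate_along c f i = f i"
proof -
  have "map_of (zip (rotate1 c) c) i = None"
    using assms by (simp add: map_of_zip_is_None)
  then show ?thesis unfolding rotate_along_def by (simp only: option.case)
qed

text \<open>Indexes a cycle by the receiver of the token of \<open>c ! q\<close>, so that
  \<open>rotate_along_nth\<close> applies termwise to sums and images over the cycle.\<close>

lemma set_as_successors:
  assumes "distinct c"
  shows "bij_betw (\<lambda>q. c ! (Suc q mod length c)) {..<length c} (set c)"
proof -
  have "bij_betw (\<lambda>q. rotate1 c ! q) {..<length (rotate1 c)} (set (rotate1 c))"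
    using assms by (intro bij_betw_nth) auto
  moreover have "bij_betw (\<lambda>q. rotate1 c ! q) {..<length c} (set c) \<longleftrightarrow>
      bij_betw (\<lambda>q. c ! (Suc q mod length c)) {..<length c} (set c)"
    by (intro bij_betw_cong) (simp add: nth_rotate1)
  ultimately show ?thesis by simp
qed

text \<open>On a finite set the orbit of \<open>x\<close> repeats a value, and the least period of
  that value yields a repetition-free cycle. As \<open>f\<close> need not be injective, the cycle
  may avoid \<open>x\<close>.\<close>

lemma periodic_orbit:
  assumes "finite B" "x \<in> B" "f ` B \<subseteq> B"
  obtains c where "c \<noteq> []" "distinct c" "set c \<subseteq> B"
    and "\<And>q. q < length c \<Longrightarrow> f (c ! q) = c ! (Suc q mod length c)"
proof -
  have closed: "(f ^^ n) y \<in> B" if "y \<in> B" for n y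
    using that assms(3) by (induction n) auto
  have "range (\<lambda>n. (f ^^ n) x) \<subseteq> B" using closed assms(2) by blast
  then have "finite (range (\<lambda>n. (f ^^ n) x))" using assms(1) finite_subset by blast
  then have "\<not> inj (\<lambda>n. (f ^^ n) x)" using finite_imageD by blast
  then obtain a b where ab: "a < b" "(f ^^ a) x = (f ^^ b) x"
    unfolding inj_on_def by (metis linorder_neqE_nat)
  define y where "y = (f ^^ a) x"
  have y: "y \<in> B" using closed assms(2) y_def by blast
  have "(f ^^ (b - a)) y = (f ^^ (b - a + a)) x" by (simp only: y_def funpow_add o_apply)
  also have "\<dots> = y" using ab by (simp add: y_def)
  finally have period: "\<exists>m>0. (f ^^ m) y = y"
    using ab(1) by (intro exI[of _ "b - a"]) simp
  define m where "m = (LEAST m. 0 < m \<and> (f ^^ m) y = y)"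
  have m: "0 < m" "(f ^^ m) y = y"
    using LeastI_ex[OF period] by (auto simp: m_def)
  have minimal: "m \<le> n" if "0 < n" "(f ^^ n) y = y" for n
    using that unfolding m_def by (intro Least_le) auto
  have neq: "(f ^^ p) y \<noteq> (f ^^ q) y" if "p < q" "q < m" for p q
  proof
    \<comment> \<open>Another \<open>m - q\<close> iterations on both sides give the period
      \<open>m - q + p\<close>, which is less than \<open>m\<close>.\<close>
    assume eq: "(f ^^ p) y = (f ^^ q) y"
    have "(f ^^ (m - q + p)) y = (f ^^ (m - q)) ((f ^^ p) y)" by (simp add: funpow_add)
    also have "\<dots> = (f ^^ (m - q + q)) y" by (simp add: eq funpow_add)
    also have "\<dots> = y" using that m by simp
    finally show False using minimal[of "m - q + p"] that by simp
  qed
  define c where "c = map (\<lambda>q. (f ^^ q) y) [0..<m]"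
  show thesis
  proof
    show "c \<noteq> []" using m by (simp add: c_def)
    show "distinct c"
      using neq by (auto simp: c_def distinct_map inj_on_def) (metis linorder_neqE_nat)
    show "set c \<subseteq> B" using closed y by (auto simp: c_def)
    show "f (c ! q) = c ! (Suc q mod length c)" if "q < length c" for q
    proof (cases "Suc q = m")
      case True
      then have "f (c ! q) = (f ^^ m) y" by (auto simp: c_def)
      with True m show ?thesis by (simp add: c_def)
    next
      case False
      with that show ?thesis by (simp add: c_def)
    qed
  qed
qed

text \<open>\<open>P\<close> stands for the set of initial priorities, which is the same at all
  times since priorities are only permuted. As \<open>card P = card N\<close>, having image
  \<open>P\<close> already forces the priorities to be pairwise distinct.\<close>

locale tp_swap = connected_graph G
  for G :: "('v, 'e) pre_digraph" +
  fixes N :: "'a set" and T :: "'v set" and P :: "nat set" and k :: nat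
    and nextVertex :: "'v \<Rightarrow> 'v \<Rightarrow> 'v"
    and closest :: "('a, 'v) tables \<Rightarrow> 'a \<Rightarrow> 'v"
  assumes finite_N: "finite N"
    and T_verts: "T \<subseteq> verts G"
    and finite_P: "finite P"
    and card_P: "card P = card N"
    and card_T: "card T = card N"
    and k_ge_2: "2 \<le> k"
    and next_vertex: "next_vertex_rule G nextVertex"
    and closest: "closest_target_rule G T closest"
begin

lemma finite_T: "finite T"
  using T_verts finite_verts finite_subset by blast

lemma nextVertex_props:
  assumes "v \<in> verts G" "\<tau> \<in> T" "v \<noteq> \<tau>"
  shows "v \<rightarrow>\<^bsub>G\<^esub> nextVertex v \<tau>" "gdist G v \<tau> = Suc (gdist G (nextVertex v \<tau>) \<tau>)"
    "nextVertex v \<tau> \<in> verts G" "nextVertex v \<tau> \<noteq> v"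
proof -
  show *: "v \<rightarrow>\<^bsub>G\<^esub> nextVertex v \<tau>" "gdist G v \<tau> = Suc (gdist G (nextVertex v \<tau>) \<tau>)"
    using next_vertex assms T_verts unfolding next_vertex_rule_def by auto
  from * show "nextVertex v \<tau> \<in> verts G" "nextVertex v \<tau> \<noteq> v"
    by (auto simp: arcs_ends_conv)
qed

subsection \<open>Reassigning targets\<close>

text \<open>What a merged table must satisfy for reassignments to succeed. Injectivity of the
  entries drives the count in \<open>candidates_nonempty\<close>; it survives because the priority
  of a member can stand only at its own target, so an overruled agent writes a value that is new to
  the table.\<close>

definition sound :: "('a, 'v) tables \<Rightarrow> bool" where
  "sound D \<longleftrightarrow> finite (NH D) \<and> TA D ` NH D \<subseteq> T \<and> PR D ` NH D \<subseteq> P \<and> inj_on (PR D) (NH D) \<and>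
     (\<forall>\<tau> q. TP D \<tau> = Some q \<longrightarrow> q \<in> P) \<and>
     (\<forall>\<tau> \<tau>' q. TP D \<tau> = Some q \<longrightarrow> TP D \<tau>' = Some q \<longrightarrow> \<tau> = \<tau>') \<and>
     (\<forall>j \<in> NH D. \<forall>\<tau>. TP D \<tau> = Some (PR D j) \<longrightarrow> \<tau> = TA D j) \<and>
     (\<forall>j \<in> NH D. Some (PR D j) \<le> TP D (TA D j))"

text \<open>
  Table entries are injective with values in \<open>P\<close>, and fewer than \<open>card T\<close> of these values
  exceed the priority of \<open>j\<close>.
\<close>

lemma candidates_nonempty:
  assumes "sound D" "j \<in> NH D"
  shows "candidates T D j \<noteq> {}"
proof
  assume none: "candidates T D j = {}"
  have gr: "Some (PR D j) < TP D \<tau>" if "\<tau> \<in> T" for \<tau>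
    using none that by (auto simp: candidates_def)
  have inj: "inj_on (\<lambda>\<tau>. the (TP D \<tau>)) T"
  proof (rule inj_onI)
    fix \<tau> \<tau>' assume "\<tau> \<in> T" "\<tau>' \<in> T" and eq: "the (TP D \<tau>) = the (TP D \<tau>')"
    then obtain q q' where "TP D \<tau> = Some q" "TP D \<tau>' = Some q'"
      using gr by (metis less_option_None option.exhaust)
    with eq assms(1) show "\<tau> = \<tau>'" by (auto simp: sound_def)
  qed
  have "the (TP D \<tau>) \<in> P - {PR D j}" if "\<tau> \<in> T" for \<tau>
    using gr[OF that] assms(1) by (cases "TP D \<tau>") (auto simp: sound_def)
  then have "card T \<le> card (P - {PR D j})"
    using inj finite_P by (intro card_inj_on_le) auto
  moreover have "PR D j \<in> P" using assms by (auto simp: sound_def)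
  ultimately show False
    using card_T card_P finite_P by (metis card_Diff1_less linorder_not_le)
qed

lemma reassign_cases:
  assumes "sound D" "j \<in> NH D"
  obtains (keep) "TP D (TA D j) = Some (PR D j)" "reassign closest j D = D"
  | (change) \<tau> where "Some (PR D j) < TP D (TA D j)" "\<tau> \<in> T" "TP D \<tau> \<le> Some (PR D j)"
      "reassign closest j D = D\<lparr>TA := (TA D)(j := \<tau>), TP := (TP D)(\<tau> := Some (PR D j))\<rparr>"
proof (cases "Some (PR D j) < TP D (TA D j)")
  case True
  have "closest D j \<in> candidates T D j"
    using closest assms candidates_nonempty[OF assms]
    by (auto simp: closest_target_rule_def is_arg_min_def)
  with True change[of "closest D j"] show thesis
    by (auto simp: candidates_def reassign_def Let_def)
next
  case False
  moreover have "Some (PR D j) \<le> TP D (TA D j)" using assms by (simp add: sound_def)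
  ultimately have "TP D (TA D j) = Some (PR D j)" by simp
  with False keep show thesis by (simp add: reassign_def)
qed

lemma reassign_frame [simp]:
  "NH (reassign closest j D) = NH D" "V (reassign closest j D) = V D"
  "PR (reassign closest j D) = PR D"
  by (simp_all add: reassign_def Let_def)

lemma fold_reassign_frame [simp]:
  "NH (fold (reassign closest) xs D) = NH D" "V (fold (reassign closest) xs D) = V D"
  "PR (fold (reassign closest) xs D) = PR D"
  by (induction xs arbitrary: D) simp_all

lemma sound_reassign:
  assumes D: "sound D" and j: "j \<in> NH D"
  shows "sound (reassign closest j D)"
  using D j
proof (cases rule: reassign_cases)
  case keep
  with D show ?thesis by simp
next
  case (change \<tau>)
  \<comment> \<open>The only place for this priority would be \<open>TA D j\<close>, but the entry
    there is strictly larger.\<close>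
  have free: "TP D \<tau>' \<noteq> Some (PR D j)" for \<tau>'
    using D j change(1) by (auto simp: sound_def)
  have other: "PR D i \<noteq> PR D j" if "i \<in> NH D" "i \<noteq> j" for i
    using D j that by (auto simp: sound_def inj_on_def)
  \<comment> \<open>A member already aiming at \<tau> is bounded by the old entry at \<tau>, hence
    by the priority of \<open>j\<close>. So the new entry does not fall below the priority of anyone
    aiming there.\<close>
  have le: "Some (PR D i) \<le> Some (PR D j)" if "i \<in> NH D" "TA D i = \<tau>" for i
  proof -
    have "Some (PR D i) \<le> TP D (TA D i)" using D that(1) by (simp add: sound_def)
    with change(3) that(2) show ?thesis by (metis order_trans)
  qed
  let ?E = "reassign closest j D"
  have TP: "TP ?E = (TP D)(\<tau> := Some (PR D j))" and TA: "TA ?E = (TA D)(j := \<tau>)"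
    using change by auto
  have PR: "inj_on (PR D) (NH D)" "PR D ` NH D \<subseteq> P" "TA D ` NH D \<subseteq> T" "finite (NH D)"
    using D by (auto simp: sound_def)
  have 1: "q \<in> P" if "TP ?E \<rho> = Some q" for \<rho> q
    using that D j PR(2) by (auto simp: TP sound_def split: if_splits)
  have 2: "\<rho> = \<rho>'" if "TP ?E \<rho> = Some q" "TP ?E \<rho>' = Some q" for \<rho> \<rho>' q
  proof -
    have "\<rho> = \<rho>'" if "TP D \<rho> = Some q" "TP D \<rho>' = Some q" using D that by (simp add: sound_def)
    with that free show ?thesis by (auto simp: TP split: if_splits)
  qed
  have 3: "\<rho> = TA ?E i" if "i \<in> NH D" "TP ?E \<rho> = Some (PR D i)" for \<rho> i
  proof (cases "i = j")
    case True
    with that free show ?thesis by (auto simp: TP TA split: if_splits)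
  next
    case False
    then have "TP D \<rho> = Some (PR D i)"
      using that other[OF that(1) False] by (auto simp: TP split: if_splits)
    with D that(1) False show ?thesis by (simp add: TA sound_def)
  qed
  have 4: "Some (PR D i) \<le> TP ?E (TA ?E i)" if "i \<in> NH D" for i
  proof (cases "i = j")
    case True
    then show ?thesis by (simp add: TP TA)
  next
    case False
    have "Some (PR D i) \<le> TP D (TA D i)" using D that by (simp add: sound_def)
    with False le[OF that] show ?thesis by (simp add: TP TA)
  qed
  have 5: "TA ?E ` NH D \<subseteq> T" using PR(3) change(2) by (auto simp: TA)
  show ?thesis
    unfolding sound_def reassign_frame
    by (intro conjI allI ballI impI PR(1,2,4) 5; (erule 1 | erule (1) 2 | erule (1) 3 | erule 4))
qed

lemma reassign_mono:
  assumes "sound D" "j \<in> NH D"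
  shows "TP D \<tau> \<le> TP (reassign closest j D) \<tau>"
  using assms by (cases rule: reassign_cases) auto

text \<open>The decreasing order settles each agent for good: the entry at its target equals its
  priority, and later agents overwrite only entries that do not exceed their own, smaller priority.
  The disjunctions about old and new entries and targets are what the global invariant needs to
  follow a token.\<close>

lemma fold_reassign:
  assumes "sound D" "set xs \<subseteq> NH D" "sorted_wrt (\<lambda>i j. PR D j < PR D i) xs"
  defines "D' \<equiv> fold (reassign closest) xs D"
  shows "sound D' \<and> (\<forall>\<tau>. TP D \<tau> \<le> TP D' \<tau>) \<and>
    (\<forall>\<tau>. TP D' \<tau> = TP D \<tau> \<or> (\<exists>j \<in> NH D. TP D' \<tau> = Some (PR D j) \<and> TA D' j = \<tau>)) \<and>
    (\<forall>j \<in> NH D. TA D' j = TA D j \<or> Some (PR D j) < TP D' (TA D j)) \<and>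
    (\<forall>j \<in> set xs. TP D' (TA D' j) = Some (PR D j))"
  using assms(2,3) unfolding D'_def
proof (induction xs rule: rev_induct)
  case Nil
  with assms(1) show ?case by simp
next
  case (snoc j xs)
  define E where "E = fold (reassign closest) xs D"
  have E: "sound E" and mono: "\<And>\<tau>. TP D \<tau> \<le> TP E \<tau>"
    and new: "\<And>\<tau>. TP E \<tau> = TP D \<tau> \<or> (\<exists>j \<in> NH D. TP E \<tau> = Some (PR D j) \<and> TA E j = \<tau>)"
    and raised: "\<And>j. j \<in> NH D \<Longrightarrow> TA E j = TA D j \<or> Some (PR D j) < TP E (TA D j)"
    and settled: "\<And>j. j \<in> set xs \<Longrightarrow> TP E (TA E j) = Some (PR D j)"
    using snoc.IH snoc.prems unfolding E_def by (simp_all add: sorted_wrt_append)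
  have [simp]: "NH E = NH D" "PR E = PR D" by (simp_all add: E_def)
  have j: "j \<in> NH E" and lower: "\<And>i. i \<in> set xs \<Longrightarrow> PR D j < PR D i"
    using snoc.prems by (auto simp: sorted_wrt_append)
  have fold: "fold (reassign closest) (xs @ [j]) D = reassign closest j E"
    by (simp add: E_def)
  from E j show ?case
  proof (cases rule: reassign_cases)
    case keep
    then show ?thesis
      unfolding fold keep(2) using E mono new raised settled by simp
  next
    case (change \<tau>)
    let ?E = "reassign closest j E"
    have TP: "TP ?E = (TP E)(\<tau> := Some (PR D j))" and TA: "TA ?E = (TA E)(j := \<tau>)"
      using change by auto
    have mono': "TP E \<rho> \<le> TP ?E \<rho>" for \<rho>
      using reassign_mono[OF E j] .
    have 1: "TP ?E \<rho> = TP D \<rho> \<or> (\<exists>j \<in> NH D. TP ?E \<rho> = Some (PR D j) \<and> TA ?E j = \<rho>)" for \<rho>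
    proof (cases "\<rho> = \<tau>")
      case True
      with j show ?thesis by (auto simp: TP TA)
    next
      case False
      consider "TP E \<rho> = TP D \<rho>"
        | i where "i \<in> NH D" "TP E \<rho> = Some (PR D i)" "TA E i = \<rho>"
        using new by blast
      then show ?thesis
      proof cases
        case 1
        with False show ?thesis by (simp add: TP)
      next
        case 2
        \<comment> \<open>For \<open>j\<close> itself the entry at its target exceeds its priority,
          or it would not be reassigned.\<close>
        then have "i \<noteq> j" using change(1) by auto
        with 2 False show ?thesis by (auto simp: TP TA)
      qed
    qed
    have 2: "TA ?E i = TA D i \<or> Some (PR D i) < TP ?E (TA D i)" if "i \<in> NH D" for i
    proof (cases "TA E i = TA D i")
      case True
      show ?thesis
      proof (cases "i = j")
        case i: True
        then have "Some (PR D i) < TP E (TA D i)" using True change(1) by simp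
        then show ?thesis using less_le_trans mono' by metis
      next
        case False
        with True show ?thesis by (simp add: TA)
      qed
    next
      case False
      with raised[OF that] show ?thesis using less_le_trans mono' by metis
    qed
    have 3: "TP ?E (TA ?E i) = Some (PR D i)" if "i \<in> set (xs @ [j])" for i
    proof (cases "i = j")
      case True
      then show ?thesis by (simp add: TP TA)
    next
      case False
      then have i: "i \<in> set xs" using that by simp
      have "TA E i \<noteq> \<tau>" using settled[OF i] lower[OF i] change(3) by auto
      with False settled[OF i] show ?thesis by (simp add: TP TA)
    qed
    have 4: "TP D \<rho> \<le> TP ?E \<rho>" for \<rho>
      using mono mono' by (rule order_trans)
    show ?thesis
      unfolding fold by (intro conjI allI ballI sound_reassign[OF E j] 1 2 3 4)
  qed
qed

end

subsection \<open>Moving tokens\<close>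

lemma image_eq_by_part:
  assumes "S \<subseteq> H" "f' ` S = f ` S" "\<And>i. i \<in> H - S \<Longrightarrow> f' i = f i"
  shows "f' ` H = f ` H"
proof -
  have "f' ` H = f' ` S \<union> f' ` (H - S)" "f ` H = f ` S \<union> f ` (H - S)"
    using assms(1) by auto
  moreover have "f' ` (H - S) = f ` (H - S)" using assms(3) by (rule image_cong[OF refl])
  ultimately show ?thesis using assms(2) by simp
qed

lemma sum_less_by_part:
  fixes f f' :: "'a \<Rightarrow> nat"
  assumes "finite H" "S \<subseteq> H" "sum f' S < sum f S" "\<And>i. i \<in> H - S \<Longrightarrow> f' i = f i"
  shows "sum f' H < sum f H"
proof -
  have "sum f' H = sum f' (H - S) + sum f' S" "sum f H = sum f (H - S) + sum f S"
    using assms(1,2) sum.subset_diff by blast+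
  moreover have "sum f' (H - S) = sum f (H - S)" using assms(4) by (rule sum.cong[OF refl])
  ultimately show ?thesis using assms(3) by simp
qed

text \<open>
  A swap moves one token a step towards its target and another one away from its target by a step;
  the weight makes the total drop because the second token leaves its target.
\<close>

definition token_weight :: "nat \<Rightarrow> nat" where
  "token_weight d = (if d = 0 then 1 else 2 * d)"

lemma token_weight_Suc: "token_weight d < token_weight (Suc d)"
  by (simp add: token_weight_def)

definition tokens :: "('a, 'v) tables \<Rightarrow> ('v \<times> nat) set" where
  "tokens D = (\<lambda>j. (TA D j, PR D j)) ` NH D"

context tp_swap
begin

definition energy :: "('a, 'v) tables \<Rightarrow> nat" where
  "energy D = (\<Sum>j \<in> NH D. token_weight (gdist G (V D j) (TA D j)))"

text \<open>The situation after all reassignments in a subgroup. Distinct targets matter for swaps: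
  exchanging two equal targets would leave the energy unchanged.\<close>

definition ready :: "('a, 'v) tables \<Rightarrow> bool" where
  "ready D \<longleftrightarrow> finite (NH D) \<and> V D ` NH D \<subseteq> verts G \<and> inj_on (V D) (NH D) \<and>
     TA D ` NH D \<subseteq> T \<and> inj_on (TA D) (NH D)"

text \<open>Keeps the reasons for which \<open>advance\<close> is idle; the mere fact that the
  tables stay the same would not reveal that the agent in the way is off its target.\<close>

definition stuck :: "('a, 'v) tables \<Rightarrow> 'a \<Rightarrow> bool" where
  "stuck D j \<longleftrightarrow> V D j = TA D j \<or>
     nextVertex (V D j) (TA D j) \<in> V D ` NH D \<and>
     (\<forall>l \<in> NH D. V D l = nextVertex (V D j) (TA D j) \<longrightarrow> V D l \<noteq> TA D l) \<and>
     (\<nexists>c. deadlock nextVertex D j c)"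

lemma advance_cases:
  obtains (stuck) "stuck D j" "advance nextVertex j D = D"
  | (move) "V D j \<noteq> TA D j" "nextVertex (V D j) (TA D j) \<notin> V D ` NH D"
      "advance nextVertex j D = D\<lparr>V := (V D)(j := nextVertex (V D j) (TA D j))\<rparr>"
  | (swap) l where "V D j \<noteq> TA D j" "l \<in> NH D" "V D l = nextVertex (V D j) (TA D j)"
      "TA D l = V D l"
      "advance nextVertex j D =
         D\<lparr>TA := (TA D)(j := TA D l, l := TA D j), PR := (PR D)(j := PR D l, l := PR D j)\<rparr>"
  | (rotate) c where "deadlock nextVertex D j c"
      "advance nextVertex j D = D\<lparr>TA := rotate_along c (TA D), PR := rotate_along c (PR D)\<rparr>"
proof -
  define v where "v = nextVertex (V D j) (TA D j)"
  consider (target) "V D j = TA D j"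
    | (free) "V D j \<noteq> TA D j" "\<not> (\<exists>l \<in> NH D. V D l = v)"
    | (occupied) "V D j \<noteq> TA D j" "\<exists>l \<in> NH D. V D l = v \<and> v = TA D l"
    | (cycle) "V D j \<noteq> TA D j" "\<exists>l \<in> NH D. V D l = v" "\<not> (\<exists>l \<in> NH D. V D l = v \<and> v = TA D l)"
      "\<exists>c. deadlock nextVertex D j c"
    | (wait) "V D j \<noteq> TA D j" "\<exists>l \<in> NH D. V D l = v" "\<not> (\<exists>l \<in> NH D. V D l = v \<and> v = TA D l)"
      "\<nexists>c. deadlock nextVertex D j c"
    by blast
  then show thesis
  proof cases
    case target
    then show thesis using stuck by (simp add: stuck_def advance_def)
  next
    case free
    have "advance nextVertex j D = D\<lparr>V := (V D)(j := v)\<rparr>"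
      unfolding advance_def Let_def v_def[symmetric] using free by simp
    moreover have "v \<notin> V D ` NH D" using free(2) by blast
    ultimately show thesis by (intro move[folded v_def, OF free(1)])
  next
    case occupied
    define l where "l = (SOME l. l \<in> NH D \<and> V D l = v \<and> v = TA D l)"
    have l: "l \<in> NH D \<and> V D l = v \<and> v = TA D l"
      unfolding l_def using occupied(2) someI_ex[of "\<lambda>l. l \<in> NH D \<and> V D l = v \<and> v = TA D l"] by blast
    then have l': "l \<in> NH D" "V D l = v" "TA D l = V D l" by metis+
    have "advance nextVertex j D =
         D\<lparr>TA := (TA D)(j := TA D l, l := TA D j), PR := (PR D)(j := PR D l, l := PR D j)\<rparr>"
      unfolding advance_def Let_def v_def[symmetric] l_def[symmetric] using occupied by auto
    then show thesis by (rule swap[folded v_def, OF occupied(1) l'])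
  next
    case cycle
    define c where "c = (SOME c. deadlock nextVertex D j c)"
    have "deadlock nextVertex D j c"
      unfolding c_def using cycle(4) by (rule someI_ex[of "deadlock nextVertex D j"])
    moreover have "advance nextVertex j D =
        D\<lparr>TA := rotate_along c (TA D), PR := rotate_along c (PR D)\<rparr>"
      unfolding advance_def Let_def v_def[symmetric] c_def[symmetric] using cycle by auto
    ultimately show thesis by (rule rotate)
  next
    case wait
    then have "advance nextVertex j D = D"
      unfolding advance_def Let_def v_def[symmetric] by auto
    moreover have "stuck D j"
    proof -
      have "v \<in> V D ` NH D" using wait(2) by blast
      moreover have "\<forall>l \<in> NH D. V D l = v \<longrightarrow> V D l \<noteq> TA D l" using wait(3) by metis
      ultimately show ?thesis unfolding stuck_def v_def[symmetric] using wait(4) by simp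
    qed
    ultimately show thesis by (intro stuck)
  qed
qed

lemma ready_if_same_tokens:
  assumes "ready D" "tokens E = tokens D" "NH E = NH D"
    and "V E ` NH D \<subseteq> verts G" "inj_on (V E) (NH D)"
  shows "ready E"
proof -
  have TA: "TA E ` NH D = TA D ` NH D"
  proof -
    have "fst ` tokens E = fst ` tokens D" using assms(2) by simp
    then show ?thesis by (simp add: tokens_def image_image assms(3))
  qed
  \<comment> \<open>Equal token sets have equally many targets, so no two agents of \<open>E\<close>
    can share one.\<close>
  then have "inj_on (TA E) (NH D)"
    using assms(1) by (intro eq_card_imp_inj_on) (simp_all add: ready_def card_image)
  with assms TA show ?thesis by (simp add: ready_def)
qed

lemma advance_effect:
  assumes D: "ready D" and j: "j \<in> NH D"
  defines "E \<equiv> advance nextVertex j D"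
  shows "ready E \<and> NH E = NH D \<and> TP E = TP D \<and> tokens E = tokens D \<and>
    (\<forall>i. i \<noteq> j \<longrightarrow> V E i = V D i) \<and> (V E j = V D j \<or> V D j \<rightarrow>\<^bsub>G\<^esub> V E j) \<and>
    (stuck D j \<and> E = D \<or> energy E < energy D)"
proof -
  have H: "finite (NH D)" "\<And>i. i \<in> NH D \<Longrightarrow> V D i \<in> verts G" "\<And>i. i \<in> NH D \<Longrightarrow> TA D i \<in> T"
    and inj: "inj_on (V D) (NH D)" "inj_on (TA D) (NH D)"
    using D by (auto simp: ready_def)
  note nextV = nextVertex_props[OF H(2,3)]
  show ?thesis
  proof (cases rule: advance_cases[where D = D and j = j])
    case stuck
    with D show ?thesis by (simp add: E_def)
  next
    case move
    let ?v = "nextVertex (V D j) (TA D j)"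
    have E: "NH E = NH D" "TP E = TP D" "TA E = TA D" "PR E = PR D" "V E = (V D)(j := ?v)"
      using move(3) by (simp_all add: E_def)
    note v = nextV[OF j j move(1)]
    have tok: "tokens E = tokens D" by (simp add: tokens_def E)
    have "inj_on (V E) (NH D)"
      using inj(1) move(2) by (auto simp: E(5) inj_on_def image_iff)
    moreover have "V E ` NH D \<subseteq> verts G" using H(2) v(3) by (auto simp: E(5))
    ultimately have "ready E" using ready_if_same_tokens[OF D tok E(1)] by simp
    moreover have "energy E < energy D"
      unfolding energy_def E(1)
      by (rule sum_less_by_part[of _ "{j}"]) (use H(1) j v(2) token_weight_Suc in \<open>auto simp: E\<close>)
    ultimately show ?thesis using tok v(1) by (simp add: E)
  next
    case (swap l)
    have E: "NH E = NH D" "TP E = TP D" "V E = V D"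
        "TA E = (TA D)(j := TA D l, l := TA D j)" "PR E = (PR D)(j := PR D l, l := PR D j)"
      using swap(5) by (simp_all add: E_def)
    note v = nextV[OF j j swap(1)]
    have lj: "l \<noteq> j" using v(4) swap(3) by auto
    have tok: "tokens E = tokens D"
      unfolding tokens_def E(1)
      by (rule image_eq_by_part[of "{j, l}"]) (use j swap(2) lj in \<open>auto simp: E\<close>)
    have ready: "ready E"
      using ready_if_same_tokens[OF D tok E(1)] D by (simp add: E ready_def)
    \<comment> \<open>Otherwise \<open>j\<close> and \<open>l\<close> would have the same target,
      since \<open>l\<close> stands on its own.\<close>
    have away: "V D l \<noteq> TA D j"
      using inj(2) j swap(2,4) lj by (auto simp: inj_on_def)
    have "gdist G (V D l) (TA D j) \<noteq> 0"
      using away gdist_eq_0_iff H(2,3) j swap(2) T_verts by blast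
    moreover have "gdist G (V D j) (TA D j) = Suc (gdist G (V D l) (TA D j))"
      using v(2) swap(3) by simp
    moreover have "gdist G (V D j) (TA D l) \<le> 1"
      using gdist_adjacent[OF v(1)] swap(3,4) by simp
    moreover have "gdist G (V D l) (TA D l) = 0"
      using gdist_self H(2) swap(2,4) by simp
    \<comment> \<open>The token coming from \<open>j\<close> is still off its target after the swap,
      so its weight drops by exactly 2. The other token goes from weight 1 to at most 2, which costs
      at most 1.\<close>
    ultimately have less: "token_weight (gdist G (V D j) (TA D l)) + token_weight (gdist G (V D l) (TA D j)) <
        token_weight (gdist G (V D j) (TA D j)) + token_weight (gdist G (V D l) (TA D l))"
      unfolding token_weight_def by auto
    have "energy E < energy D"
      unfolding energy_def E(1)
    proof (rule sum_less_by_part[OF H(1), of "{j, l}"])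
      show "(\<Sum>i \<in> {j, l}. token_weight (gdist G (V E i) (TA E i))) <
          (\<Sum>i \<in> {j, l}. token_weight (gdist G (V D i) (TA D i)))"
        using less lj by (simp add: E)
    qed (use j swap(2) in \<open>simp_all add: E\<close>)
    then show ?thesis using tok ready by (simp add: E)
  next
    case (rotate c)
    have E: "NH E = NH D" "TP E = TP D" "V E = V D"
        "TA E = rotate_along c (TA D)" "PR E = rotate_along c (PR D)"
      using rotate(2) by (simp_all add: E_def)
    let ?suc = "\<lambda>q. Suc q mod length c"
    have c: "distinct c" "set c \<subseteq> NH D" "c \<noteq> []"
      and step: "\<And>q. q < length c \<Longrightarrow> V D (c ! q) \<noteq> TA D (c ! q) \<and>
        nextVertex (V D (c ! q)) (TA D (c ! q)) = V D (c ! ?suc q)"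
      using rotate(1) by (auto simp: deadlock_def)
    have nth: "bij_betw (\<lambda>q. c ! q) {..<length c} (set c)"
      using c(1) by (intro bij_betw_nth) auto
    note suc = set_as_successors[OF c(1)]
    have tok: "tokens E = tokens D"
      unfolding tokens_def E(1)
    proof (rule image_eq_by_part[OF c(2)])
      have "(\<lambda>i. (TA E i, PR E i)) ` set c =
          (\<lambda>q. (TA E (c ! ?suc q), PR E (c ! ?suc q))) ` {..<length c}"
        by (subst bij_betw_imp_surj_on[OF suc, symmetric]) (simp only: image_image)
      also have "\<dots> = (\<lambda>q. (TA D (c ! q), PR D (c ! q))) ` {..<length c}"
        using c(1) by (intro image_cong) (simp_all add: E rotate_along_nth)
      also have "\<dots> = (\<lambda>i. (TA D i, PR D i)) ` set c"
        by (subst bij_betw_imp_surj_on[OF nth, symmetric]) (simp only: image_image)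
      finally show "(\<lambda>i. (TA E i, PR E i)) ` set c = (\<lambda>i. (TA D i, PR D i)) ` set c" .
    qed (simp add: E rotate_along_outside)
    have ready: "ready E"
      using ready_if_same_tokens[OF D tok E(1)] D by (simp add: E ready_def)
    \<comment> \<open>The token of \<open>c ! q\<close> passes to the agent on its next vertex, so
      every token of the cycle gains a step.\<close>
    have less: "token_weight (gdist G (V D (c ! ?suc q)) (TA D (c ! q))) <
        token_weight (gdist G (V D (c ! q)) (TA D (c ! q)))" if "q < length c" for q
    proof -
      have "c ! q \<in> NH D" using that c(2) by auto
      with nextV(2) step[OF that] show ?thesis using token_weight_Suc by metis
    qed
    have "(\<Sum>i \<in> set c. token_weight (gdist G (V E i) (TA E i))) =
        (\<Sum>q<length c. token_weight (gdist G (V E (c ! ?suc q)) (TA E (c ! ?suc q))))"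
      using sum.reindex_bij_betw[OF suc, of "\<lambda>i. token_weight (gdist G (V E i) (TA E i))"] by simp
    also have "\<dots> = (\<Sum>q<length c. token_weight (gdist G (V D (c ! ?suc q)) (TA D (c ! q))))"
      using c(1) by (intro sum.cong) (simp_all add: E rotate_along_nth)
    also have "\<dots> < (\<Sum>q<length c. token_weight (gdist G (V D (c ! q)) (TA D (c ! q))))"
      using less c(3) by (intro sum_strict_mono) auto
    also have "\<dots> = (\<Sum>i \<in> set c. token_weight (gdist G (V D i) (TA D i)))"
      using sum.reindex_bij_betw[OF nth, of "\<lambda>i. token_weight (gdist G (V D i) (TA D i))"] by simp
    finally have "energy E < energy D"
      unfolding energy_def E(1)
      by (intro sum_less_by_part[OF H(1) c(2)]) (auto simp: E rotate_along_outside)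
    then show ?thesis using tok ready by (simp add: E)
  qed
qed

text \<open>\<open>advance\<close> displaces only the agent it processes, and each agent is
  processed once, so nobody travels more than one arc per timestep. As soon as one agent acts, the
  energy has dropped, and later agents cannot raise it again; otherwise all of them are stuck in the
  same tables \<open>D\<close>.\<close>

lemma fold_advance_effect:
  assumes "ready D" "set xs \<subseteq> NH D" "distinct xs"
  defines "E \<equiv> fold (advance nextVertex) xs D"
  shows "ready E \<and> NH E = NH D \<and> TP E = TP D \<and> tokens E = tokens D \<and>
    (\<forall>i. V E i = V D i \<or> i \<in> set xs \<and> V D i \<rightarrow>\<^bsub>G\<^esub> V E i) \<and>
    ((\<forall>j \<in> set xs. stuck D j) \<and> E = D \<or> energy E < energy D)"
  using assms(1-3) unfolding E_def
proof (induction xs arbitrary: D)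
  case Nil
  then show ?case by simp
next
  case (Cons j xs)
  define E where "E = advance nextVertex j D"
  define F where "F = fold (advance nextVertex) xs E"
  have eff: "ready E" "NH E = NH D" "TP E = TP D" "tokens E = tokens D"
    "\<And>i. i \<noteq> j \<Longrightarrow> V E i = V D i" "V E j = V D j \<or> V D j \<rightarrow>\<^bsub>G\<^esub> V E j"
    "stuck D j \<and> E = D \<or> energy E < energy D"
    using advance_effect[of D j] Cons.prems unfolding E_def by auto
  have IH: "ready F" "NH F = NH E" "TP F = TP E" "tokens F = tokens E"
    "\<And>i. V F i = V E i \<or> i \<in> set xs \<and> V E i \<rightarrow>\<^bsub>G\<^esub> V F i"
    "(\<forall>j \<in> set xs. stuck E j) \<and> F = E \<or> energy F < energy E"
    using Cons.IH[of E] eff Cons.prems unfolding F_def by auto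
  have "V F i = V D i \<or> i \<in> set (j # xs) \<and> V D i \<rightarrow>\<^bsub>G\<^esub> V F i" for i
    using IH(5)[of i] eff(5)[of i] eff(6) Cons.prems(3) by (cases "i = j") auto
  moreover have "(\<forall>i \<in> set (j # xs). stuck D i) \<and> F = D \<or> energy F < energy D"
    using IH(6) eff(7) by auto
  moreover have "fold (advance nextVertex) (j # xs) D = F" by (simp add: F_def E_def)
  ultimately show ?case using IH(1-4) eff(2-4) by simp
qed

text \<open>
  If every agent is stuck, the occupant of the next vertex of an agent that is not at its target is
  not at its target either. Iterating this leads to a deadlock.
\<close>

lemma all_stuck_at_target:
  assumes D: "ready D" and stuck: "\<And>j. j \<in> NH D \<Longrightarrow> stuck D j" and "j \<in> NH D"
  shows "V D j = TA D j"
proof (rule ccontr)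
  assume "V D j \<noteq> TA D j"
  define B where "B = {j \<in> NH D. V D j \<noteq> TA D j}"
  have "j \<in> B" "finite B" using assms \<open>V D j \<noteq> TA D j\<close> by (auto simp: B_def ready_def)
  have "\<exists>l. l \<in> B \<and> V D l = nextVertex (V D i) (TA D i)" if "i \<in> B" for i
  proof -
    from that stuck[of i] obtain l where "l \<in> NH D" "V D l = nextVertex (V D i) (TA D i)"
      "V D l \<noteq> TA D l"
      by (auto simp: B_def stuck_def)
    then show ?thesis by (auto simp: B_def)
  qed
  then obtain f where f: "\<And>i. i \<in> B \<Longrightarrow> f i \<in> B \<and> V D (f i) = nextVertex (V D i) (TA D i)"
    by metis
  obtain c where c: "c \<noteq> []" "distinct c" "set c \<subseteq> B"
    and succ: "\<And>q. q < length c \<Longrightarrow> f (c ! q) = c ! (Suc q mod length c)"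
    using periodic_orbit[OF \<open>finite B\<close> \<open>j \<in> B\<close>, of f] f by blast
  have mem: "c ! q \<in> B" if "q < length c" for q using c(3) that by auto
  have "length c \<noteq> 1"
  proof
    assume "length c = 1"
    then have "f (c ! 0) = c ! 0" using succ[of 0] by simp
    moreover have "c ! 0 \<in> B" using mem \<open>length c = 1\<close> by simp
    ultimately have "nextVertex (V D (c ! 0)) (TA D (c ! 0)) = V D (c ! 0)" using f by metis
    with \<open>c ! 0 \<in> B\<close> D nextVertex_props(4) show False
      unfolding B_def ready_def by blast
  qed
  with c(1) have "length c \<ge> 2" by (cases c rule: list.exhaust) (auto simp: Suc_le_eq)
  moreover have "V D (c ! q) \<noteq> TA D (c ! q) \<and>
      nextVertex (V D (c ! q)) (TA D (c ! q)) = V D (c ! (Suc q mod length c))"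
    if "q < length c" for q
    using mem[OF that] f[OF mem[OF that]] succ[OF that] by (simp add: B_def)
  \<comment> \<open>The cycle reached from \<open>j\<close> may avoid \<open>j\<close>, so the
    contradiction is with \<open>c ! 0\<close> being stuck.\<close>
  ultimately have "deadlock nextVertex D (c ! 0) c"
    using c by (auto simp: deadlock_def B_def)
  moreover have "c ! 0 \<in> B" using mem c(1) by simp
  ultimately show False using stuck by (auto simp: B_def stuck_def)
qed

section \<open>The net effect of TP-UPDATE on one subgroup\<close>

lemma tp_update_effect:
  assumes D: "sound D" and V: "V D ` NH D \<subseteq> verts G" "inj_on (V D) (NH D)"
  defines "E \<equiv> tp_update nextVertex closest D"
  shows "NH E = NH D" "TA E ` NH D \<subseteq> T" "PR E ` NH D = PR D ` NH D"
    and "V E ` NH D \<subseteq> verts G" "inj_on (V E) (NH D)"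
    and "\<And>i. V E i = V D i \<or> V D i \<rightarrow>\<^bsub>G\<^esub> V E i"
    and "\<And>\<tau>. TP D \<tau> \<le> TP E \<tau>"
    and "\<And>\<tau>. TP E \<tau> = TP D \<tau> \<or> (\<exists>i \<in> NH D. TP E \<tau> = Some (PR E i) \<and> TA E i = \<tau>)"
    and "\<And>j. j \<in> NH D \<Longrightarrow>
      \<exists>i \<in> NH D. PR E i = PR D j \<and> (TA E i = TA D j \<or> Some (PR D j) < TP E (TA D j))"
    and "\<And>i. i \<in> NH D \<Longrightarrow> TP E (TA E i) = Some (PR E i)"
    and "(\<And>\<tau>. \<tau> \<in> T \<Longrightarrow> TP E \<tau> = TP D \<tau>) \<Longrightarrow>
      energy E < energy D \<or> energy E = energy D \<and> (\<forall>i \<in> NH D. V E i = TA E i)"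
proof -
  define xs where "xs = rev (sorted_key_list_of_set (PR D) (NH D))"
  define R where "R = fold (reassign closest) xs D"
  have E: "E = fold (advance nextVertex) xs R"
    by (simp add: E_def R_def xs_def tp_update_def Let_def)
  have fin: "finite (NH D)" and injPR: "inj_on (PR D) (NH D)" using D by (auto simp: sound_def)
  have xs: "set xs = NH D" "sorted_wrt (\<lambda>i j. PR D j < PR D i) xs"
    unfolding xs_def using rev_sorted_key_list_of_set[OF fin injPR] .
  have "distinct (map (PR D) xs)"
    using xs(2) by (induction xs) auto
  then have distinct: "distinct xs" by (simp add: distinct_map)
  have R: "sound R" "\<And>\<tau>. TP D \<tau> \<le> TP R \<tau>"
    "\<And>\<tau>. TP R \<tau> = TP D \<tau> \<or> (\<exists>j \<in> NH D. TP R \<tau> = Some (PR D j) \<and> TA R j = \<tau>)"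
    "\<And>j. j \<in> NH D \<Longrightarrow> TA R j = TA D j \<or> Some (PR D j) < TP R (TA D j)"
    "\<And>j. j \<in> NH D \<Longrightarrow> TP R (TA R j) = Some (PR D j)"
    using fold_reassign[OF D _ xs(2)] xs(1) unfolding R_def by simp_all
  have [simp]: "NH R = NH D" "V R = V D" "PR R = PR D" by (simp_all add: R_def)
  \<comment> \<open>After the reassignments the entry at a member's target is its priority, so a
    common target would mean a common priority.\<close>
  have "inj_on (TA R) (NH D)"
  proof (rule inj_onI)
    fix i j assume ij: "i \<in> NH D" "j \<in> NH D" "TA R i = TA R j"
    then have "PR D i = PR D j" using R(5)[of i] R(5)[of j] by simp
    with injPR ij show "i = j" by (simp add: inj_on_def)
  qed
  then have ready: "ready R"
    using R(1) V fin by (simp add: ready_def sound_def)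
  have adv: "ready E" "NH E = NH D" "TP E = TP R" "tokens E = tokens R"
    "\<And>i. V E i = V D i \<or> V D i \<rightarrow>\<^bsub>G\<^esub> V E i"
    "(\<forall>j \<in> NH D. stuck R j) \<and> E = R \<or> energy E < energy R"
    using fold_advance_effect[OF ready _ distinct] xs(1) unfolding E by auto
  have forward: "\<exists>i \<in> NH D. TA E i = TA R j \<and> PR E i = PR D j" if "j \<in> NH D" for j
  proof -
    have "(TA R j, PR R j) \<in> tokens E" using that unfolding adv(4) by (auto simp: tokens_def)
    then show ?thesis by (auto simp: tokens_def adv(2))
  qed
  have backward: "\<exists>i \<in> NH D. TA E j = TA R i \<and> PR E j = PR D i" if "j \<in> NH D" for j
  proof -
    have "(TA E j, PR E j) \<in> tokens R"
      using that unfolding adv(4)[symmetric] by (auto simp: tokens_def adv(2))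
    then show ?thesis by (auto simp: tokens_def)
  qed
  show "NH E = NH D" by (rule adv(2))
  show "TA E ` NH D \<subseteq> T" "V E ` NH D \<subseteq> verts G" "inj_on (V E) (NH D)"
    using adv(1,2) by (auto simp: ready_def)
  show "PR E ` NH D = PR D ` NH D"
  proof
    show "PR E ` NH D \<subseteq> PR D ` NH D" using backward by fastforce
    show "PR D ` NH D \<subseteq> PR E ` NH D" using forward by (metis image_subsetI rev_image_eqI)
  qed
  show "V E i = V D i \<or> V D i \<rightarrow>\<^bsub>G\<^esub> V E i" for i by (rule adv(5))
  show "TP D \<tau> \<le> TP E \<tau>" for \<tau> unfolding adv(3) by (rule R(2))
  show "TP E \<tau> = TP D \<tau> \<or> (\<exists>i \<in> NH D. TP E \<tau> = Some (PR E i) \<and> TA E i = \<tau>)" for \<tau>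
    unfolding adv(3) using R(3)[of \<tau>] forward by metis
  show "\<exists>i \<in> NH D. PR E i = PR D j \<and> (TA E i = TA D j \<or> Some (PR D j) < TP E (TA D j))"
    if "j \<in> NH D" for j
    unfolding adv(3) using R(4)[OF that] forward[OF that] by metis
  show "TP E (TA E i) = Some (PR E i)" if "i \<in> NH D" for i
    unfolding adv(3) using R(5) backward[OF that] by metis
  show "energy E < energy D \<or> energy E = energy D \<and> (\<forall>i \<in> NH D. V E i = TA E i)"
    if same: "\<And>\<tau>. \<tau> \<in> T \<Longrightarrow> TP E \<tau> = TP D \<tau>"
  proof -
    \<comment> \<open>The priority of \<open>j\<close> stands at its target after the reassignments,
      hence already in the unchanged table of \<open>D\<close>, where soundness allows it only at
      the old target.\<close>
    have "TA R j = TA D j" if "j \<in> NH D" for j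
    proof -
      have "TA R j \<in> T" using R(1) that by (auto simp: sound_def)
      then have "TP D (TA R j) = Some (PR D j)"
        using same R(5)[OF that] by (simp add: adv(3))
      with D that show ?thesis by (simp add: sound_def)
    qed
    then have "energy R = energy D" by (simp add: energy_def)
    moreover have "\<forall>i \<in> NH D. V R i = TA R i" if "\<forall>j \<in> NH D. stuck R j"
      using all_stuck_at_target[OF ready] that by simp
    ultimately show ?thesis using adv(6) by auto
  qed
qed

subsection \<open>The global state\<close>

text \<open>
  A target and its priority travel together as a token. The last two conjuncts express that
  information about a token is always stale in a harmless way: a table that still shows an old
  target of the token is overruled by the table of the agent that holds the token, and by every
  table that knows a later target of the token.
\<close>

definition invar :: "('a, 'v) state \<Rightarrow> bool" where
  "invar \<sigma> \<longleftrightarrow> pos \<sigma> ` N \<subseteq> verts G \<and> inj_on (pos \<sigma>) N \<and> targ \<sigma> ` N \<subseteq> T \<and> prio \<sigma> ` N = P \<and>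
     (\<forall>i \<in> N. \<forall>\<tau> q. tptab \<sigma> i \<tau> = Some q \<longrightarrow> q \<in> P) \<and>
     (\<forall>h \<in> N. Some (prio \<sigma> h) \<le> tptab \<sigma> h (targ \<sigma> h)) \<and>
     (\<forall>h \<in> N. \<forall>i \<in> N. \<forall>\<tau>. tptab \<sigma> i \<tau> = Some (prio \<sigma> h) \<longrightarrow>
        \<tau> = targ \<sigma> h \<or> Some (prio \<sigma> h) < tptab \<sigma> h \<tau>) \<and>
     (\<forall>i \<in> N. \<forall>j \<in> N. \<forall>\<tau> \<tau>' q. tptab \<sigma> i \<tau> = Some q \<longrightarrow> tptab \<sigma> j \<tau>' = Some q \<longrightarrow>
        \<tau> = \<tau>' \<or> Some q < tptab \<sigma> i \<tau>' \<or> Some q < tptab \<sigma> j \<tau>)"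

lemma invarD:
  assumes "invar \<sigma>"
  shows "pos \<sigma> ` N \<subseteq> verts G" "inj_on (pos \<sigma>) N" "targ \<sigma> ` N \<subseteq> T" "prio \<sigma> ` N = P"
    and "\<And>i \<tau> q. i \<in> N \<Longrightarrow> tptab \<sigma> i \<tau> = Some q \<Longrightarrow> q \<in> P"
    and "\<And>h. h \<in> N \<Longrightarrow> Some (prio \<sigma> h) \<le> tptab \<sigma> h (targ \<sigma> h)"
    and "\<And>h i \<tau>. h \<in> N \<Longrightarrow> i \<in> N \<Longrightarrow> tptab \<sigma> i \<tau> = Some (prio \<sigma> h) \<Longrightarrow>
      \<tau> = targ \<sigma> h \<or> Some (prio \<sigma> h) < tptab \<sigma> h \<tau>"
    and "\<And>i j \<tau> \<tau>' q. i \<in> N \<Longrightarrow> j \<in> N \<Longrightarrow> tptab \<sigma> i \<tau> = Some q \<Longrightarrow> tptab \<sigma> j \<tau>' = Some q \<Longrightarrow>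
      \<tau> = \<tau>' \<or> Some q < tptab \<sigma> i \<tau>' \<or> Some q < tptab \<sigma> j \<tau>"
    and "inj_on (prio \<sigma>) N"
proof -
  show "inj_on (prio \<sigma>) N"
    using assms card_P finite_N by (intro eq_card_imp_inj_on) (auto simp: invar_def)
qed (use assms in \<open>simp_all add: invar_def\<close>)

section \<open>Subgroups and their merged tables\<close>

abbreviation subgroup :: "('a, 'v) state \<Rightarrow> 'a \<Rightarrow> 'a set" where
  "subgroup \<equiv> subgroup_of G N k"

lemma subgroup_subset: "subgroup \<sigma> i \<subseteq> N"
  by (auto simp: subgroup_of_def)

lemma finite_subgroup: "finite (subgroup \<sigma> i)"
  using subgroup_subset finite_N by (rule finite_subset)

lemma subgroup_self: "i \<in> N \<Longrightarrow> i \<in> subgroup \<sigma> i"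
  by (simp add: subgroup_of_def)

lemma in_subgroup_if_close:
  assumes "i \<in> N" "j \<in> N" "gdist G (pos \<sigma> i) (pos \<sigma> j) \<le> k"
  shows "j \<in> subgroup \<sigma> i"
  using assms by (auto simp: subgroup_of_def direct_comm_def)

lemma subgroup_eq:
  assumes "pos \<sigma> ` N \<subseteq> verts G" "j \<in> subgroup \<sigma> i"
  shows "subgroup \<sigma> j = subgroup \<sigma> i"
proof -
  have "sym (direct_comm G N k \<sigma>)"
    using assms(1) gdist_commute by (auto simp: sym_def direct_comm_def image_subset_iff)
  then have sym: "sym ((direct_comm G N k \<sigma>)\<^sup>*)" by (rule sym_rtrancl)
  have "(i, j) \<in> (direct_comm G N k \<sigma>)\<^sup>*" using assms(2) by (simp add: subgroup_of_def)
  with symD[OF sym this] show ?thesis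
    unfolding subgroup_of_def by (auto intro: rtrancl_trans)
qed

lemma collect_sel [simp]:
  "NH (collect G N k \<sigma> i) = subgroup \<sigma> i"
  "V (collect G N k \<sigma> i) = restrict (pos \<sigma>) (subgroup \<sigma> i)"
  "TA (collect G N k \<sigma> i) = restrict (targ \<sigma>) (subgroup \<sigma> i)"
  "PR (collect G N k \<sigma> i) = restrict (prio \<sigma>) (subgroup \<sigma> i)"
  by (simp_all add: collect_def Let_def)

lemma merged_table:
  assumes "i \<in> N"
  shows "\<exists>j \<in> subgroup \<sigma> i. TP (collect G N k \<sigma> i) \<tau> = tptab \<sigma> j \<tau>"
    and "j \<in> subgroup \<sigma> i \<Longrightarrow> tptab \<sigma> j \<tau> \<le> TP (collect G N k \<sigma> i) \<tau>"
proof -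
  have TP: "TP (collect G N k \<sigma> i) \<tau> = Max ((\<lambda>j. tptab \<sigma> j \<tau>) ` subgroup \<sigma> i)"
    by (simp add: collect_def Let_def)
  obtain l where "l \<in> subgroup \<sigma> i" "TP (collect G N k \<sigma> i) \<tau> = tptab \<sigma> l \<tau>"
    "\<And>j. j \<in> subgroup \<sigma> i \<Longrightarrow> tptab \<sigma> j \<tau> \<le> tptab \<sigma> l \<tau>"
    using Max_image_cases[OF finite_subgroup subgroup_self[OF assms], of \<sigma> "\<lambda>j. tptab \<sigma> j \<tau>"]
    unfolding TP by metis
  then show "\<exists>j \<in> subgroup \<sigma> i. TP (collect G N k \<sigma> i) \<tau> = tptab \<sigma> j \<tau>"
    and "j \<in> subgroup \<sigma> i \<Longrightarrow> tptab \<sigma> j \<tau> \<le> TP (collect G N k \<sigma> i) \<tau>"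
    by auto
qed

text \<open>Merging removes what is stale: an entry that survives the maximum is exceeded by no
  member's table, which rules out the alternatives of \<open>invar\<close> that a record is
  overruled.\<close>

lemma sound_collect:
  assumes inv: "invar \<sigma>" and i: "i \<in> N"
  shows "sound (collect G N k \<sigma> i)"
proof -
  let ?H = "subgroup \<sigma> i" and ?D = "collect G N k \<sigma> i"
  note I = invarD[OF inv]
  have H: "\<And>j. j \<in> ?H \<Longrightarrow> j \<in> N" using subgroup_subset by blast
  note some = merged_table(1)[OF i] and upper = merged_table(2)[OF i]
  have 1: "q \<in> P" if "TP ?D \<tau> = Some q" for \<tau> q
    using some[of \<sigma> \<tau>] that I(5) H by metis
  have 2: "\<tau> = \<tau>'" if \<tau>: "TP ?D \<tau> = Some q" and \<tau>': "TP ?D \<tau>' = Some q" for \<tau> \<tau>' q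
  proof -
    obtain a b where a: "a \<in> ?H" "tptab \<sigma> a \<tau> = Some q" and b: "b \<in> ?H" "tptab \<sigma> b \<tau>' = Some q"
      using some[of \<sigma> \<tau>] some[of \<sigma> \<tau>'] \<tau> \<tau>' by metis
    have "tptab \<sigma> a \<tau>' \<le> Some q" "tptab \<sigma> b \<tau> \<le> Some q"
      using upper[OF a(1), of \<tau>'] upper[OF b(1), of \<tau>] \<tau> \<tau>' by simp_all
    with I(8)[OF H[OF a(1)] H[OF b(1)] a(2) b(2)] show ?thesis by auto
  qed
  have 3: "\<tau> = TA ?D h" if h: "h \<in> ?H" and \<tau>: "TP ?D \<tau> = Some (PR ?D h)" for h \<tau>
  proof -
    obtain a where a: "a \<in> ?H" "tptab \<sigma> a \<tau> = Some (prio \<sigma> h)"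
      using some[of \<sigma> \<tau>] \<tau> h by auto
    have "tptab \<sigma> h \<tau> \<le> Some (prio \<sigma> h)" using upper[OF h, of \<tau>] \<tau> h by simp
    with I(7)[OF H[OF h] H[OF a(1)] a(2)] h show ?thesis by auto
  qed
  have 4: "Some (PR ?D h) \<le> TP ?D (TA ?D h)" if "h \<in> ?H" for h
    using order_trans[OF I(6)[OF H[OF that]] upper[OF that]] that by simp
  have 5: "TA ?D ` ?H \<subseteq> T" "PR ?D ` ?H \<subseteq> P" "inj_on (PR ?D) ?H"
    using I(3,4) inj_on_subset[OF I(9) subgroup_subset[of \<sigma> i]] H
    by (auto simp: inj_on_restrict_eq)
  show ?thesis
    unfolding sound_def collect_sel(1)
    by (intro conjI allI ballI impI finite_subgroup 5;
        (erule 1 | erule (1) 2 | erule (1) 3 | erule 4))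
qed

section \<open>One synchronous timestep\<close>

abbreviation step :: "('a, 'v) state \<Rightarrow> ('a, 'v) state" where
  "step \<equiv> tp_swap_step G N k nextVertex closest"

definition updated :: "('a, 'v) state \<Rightarrow> 'a \<Rightarrow> ('a, 'v) tables" where
  "updated \<sigma> i = tp_update nextVertex closest (collect G N k \<sigma> i)"

lemma step_sel [simp]:
  "pos (step \<sigma>) i = V (updated \<sigma> i) i" "targ (step \<sigma>) i = TA (updated \<sigma> i) i"
  "prio (step \<sigma>) i = PR (updated \<sigma> i) i" "tptab (step \<sigma>) i = TP (updated \<sigma> i)"
  by (simp_all add: tp_swap_step_def updated_def Let_def)

lemma updated_eq:
  assumes "invar \<sigma>" "j \<in> subgroup \<sigma> i"
  shows "updated \<sigma> j = updated \<sigma> i"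
  using subgroup_eq[OF invarD(1)[OF assms(1)] assms(2)] by (simp add: updated_def collect_def)

lemma updated_effect:
  assumes inv: "invar \<sigma>" and i: "i \<in> N"
  defines "H \<equiv> subgroup \<sigma> i" and "D \<equiv> collect G N k \<sigma> i" and "E \<equiv> updated \<sigma> i"
  shows "NH E = H" "TA E ` H \<subseteq> T" "PR E ` H = prio \<sigma> ` H"
    and "V E ` H \<subseteq> verts G" "inj_on (V E) H"
    and "\<And>j. j \<in> H \<Longrightarrow> V E j = pos \<sigma> j \<or> pos \<sigma> j \<rightarrow>\<^bsub>G\<^esub> V E j"
    and "\<And>\<tau>. TP D \<tau> \<le> TP E \<tau>"
    and "\<And>\<tau>. TP E \<tau> = TP D \<tau> \<or> (\<exists>j \<in> H. TP E \<tau> = Some (PR E j) \<and> TA E j = \<tau>)"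
    and "\<And>j. j \<in> H \<Longrightarrow> \<exists>l \<in> H. PR E l = prio \<sigma> j \<and>
      (TA E l = targ \<sigma> j \<or> Some (prio \<sigma> j) < TP E (targ \<sigma> j))"
    and "\<And>j. j \<in> H \<Longrightarrow> TP E (TA E j) = Some (PR E j)"
    and "(\<And>\<tau>. \<tau> \<in> T \<Longrightarrow> TP E \<tau> = TP D \<tau>) \<Longrightarrow>
      energy E < energy D \<or> energy E = energy D \<and> (\<forall>j \<in> H. V E j = TA E j)"
proof -
  have V: "V D ` NH D \<subseteq> verts G" "inj_on (V D) (NH D)"
    using invarD(1)[OF inv] inj_on_subset[OF invarD(2)[OF inv] subgroup_subset[of \<sigma> i]]
      subgroup_subset[of \<sigma> i]
    by (auto simp: D_def inj_on_restrict_eq)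
  note upd = tp_update_effect[OF sound_collect[OF inv i] V[unfolded D_def]]
  have PR: "PR D ` H = prio \<sigma> ` H" by (simp add: D_def H_def)
  show "NH E = H" "TA E ` H \<subseteq> T" "PR E ` H = prio \<sigma> ` H" "V E ` H \<subseteq> verts G" "inj_on (V E) H"
    using upd(1-5) by (simp_all add: H_def E_def updated_def)
  show "V E j = pos \<sigma> j \<or> pos \<sigma> j \<rightarrow>\<^bsub>G\<^esub> V E j" if "j \<in> H" for j
    using upd(6)[of j] that by (simp add: H_def E_def updated_def)
  show "TP D \<tau> \<le> TP E \<tau>" for \<tau> using upd(7) by (simp add: D_def E_def updated_def)
  show "TP E \<tau> = TP D \<tau> \<or> (\<exists>j \<in> H. TP E \<tau> = Some (PR E j) \<and> TA E j = \<tau>)" for \<tau>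
    using upd(8)[of \<tau>] by (simp add: H_def D_def E_def updated_def)
  show "\<exists>l \<in> H. PR E l = prio \<sigma> j \<and> (TA E l = targ \<sigma> j \<or> Some (prio \<sigma> j) < TP E (targ \<sigma> j))"
    if "j \<in> H" for j
    using upd(9)[of j] that by (simp add: H_def E_def updated_def)
  show "TP E (TA E j) = Some (PR E j)" if "j \<in> H" for j
    using upd(10)[of j] that by (simp add: H_def E_def updated_def)
  show "energy E < energy D \<or> energy E = energy D \<and> (\<forall>j \<in> H. V E j = TA E j)"
    if "\<And>\<tau>. \<tau> \<in> T \<Longrightarrow> TP E \<tau> = TP D \<tau>"
    using upd(11) that by (simp add: H_def D_def E_def updated_def)
qed

lemma updated_table_ge:
  assumes "invar \<sigma>" "i \<in> N"
  shows "tptab \<sigma> i \<tau> \<le> tptab (step \<sigma>) i \<tau>"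
  using merged_table(2)[OF assms(2) subgroup_self[OF assms(2)]] updated_effect(7)[OF assms]
  by (auto intro: order_trans)

text \<open>An entry of a new table either copies an old entry of a member of the same subgroup, or
  shows a token now held in that subgroup at its present target. Copied entries stay overruled
  because tables only grow; entries of the second kind are compared with other tables through the
  holder of the token.\<close>

lemma invar_step:
  assumes inv: "invar \<sigma>"
  shows "invar (step \<sigma>)"
proof -
  let ?H = "subgroup \<sigma>" and ?E = "updated \<sigma>" and ?\<sigma> = "step \<sigma>"
  note I = invarD[OF inv] and U = updated_effect[OF inv]
  have self: "\<And>i. i \<in> N \<Longrightarrow> i \<in> ?H i" by (rule subgroup_self)
  have HN: "\<And>i j. j \<in> ?H i \<Longrightarrow> j \<in> N" using subgroup_subset by blast
  have same: "?E j = ?E i" if "j \<in> ?H i" for i j using updated_eq[OF inv that] .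

  have pos: "pos ?\<sigma> ` N \<subseteq> verts G" using U(4) self by fastforce
  have targ: "targ ?\<sigma> ` N \<subseteq> T" using U(2) self by fastforce
  have prio: "prio ?\<sigma> ` N = P"
  proof (intro subset_antisym subsetI)
    fix q assume "q \<in> prio ?\<sigma> ` N"
    then obtain i where i: "i \<in> N" "q = PR (?E i) i" by auto
    then have "q \<in> prio \<sigma> ` ?H i" using U(3)[OF i(1)] self by blast
    then show "q \<in> P" using HN I(4) by blast
  next
    fix q assume "q \<in> P"
    then obtain i where i: "i \<in> N" "q = prio \<sigma> i" using I(4) by blast
    then have "q \<in> PR (?E i) ` ?H i" using U(3)[OF i(1)] self by blast
    then obtain j where j: "j \<in> ?H i" "q = PR (?E i) j" by blast
    then have "q = prio ?\<sigma> j" using same by simp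
    then show "q \<in> prio ?\<sigma> ` N" using HN j(1) by blast
  qed
  have injP: "inj_on (prio ?\<sigma>) N"
    using prio card_P finite_N by (intro eq_card_imp_inj_on) simp_all
  have injV: "inj_on (pos ?\<sigma>) N"
  proof (rule inj_onI)
    fix i j assume i: "i \<in> N" and j: "j \<in> N" and eq: "pos ?\<sigma> i = pos ?\<sigma> j"
    let ?v = "pos ?\<sigma> i"
    have near: "pos \<sigma> l = pos ?\<sigma> l \<or> pos \<sigma> l \<rightarrow>\<^bsub>G\<^esub> pos ?\<sigma> l" if "l \<in> N" for l
      using U(6)[OF that self[OF that]] by auto
    have "gdist G (pos \<sigma> i) (pos \<sigma> j) \<le> 2"
    proof -
      have verts: "pos \<sigma> i \<in> verts G" "pos \<sigma> j \<in> verts G" using I(1) i j by auto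
      consider "pos \<sigma> i = ?v" "pos \<sigma> j = ?v" | "pos \<sigma> i = ?v" "pos \<sigma> j \<rightarrow>\<^bsub>G\<^esub> ?v"
        | "pos \<sigma> i \<rightarrow>\<^bsub>G\<^esub> ?v" "pos \<sigma> j = ?v" | "pos \<sigma> i \<rightarrow>\<^bsub>G\<^esub> ?v" "pos \<sigma> j \<rightarrow>\<^bsub>G\<^esub> ?v"
        using near[OF i] near[OF j] eq by metis
      then show ?thesis
      proof cases
        case 1
        then show ?thesis using gdist_self verts by simp
      next
        case 2
        then show ?thesis using gdist_adjacent[OF 2(2)] gdist_commute[OF verts] by simp
      next
        case 3
        then show ?thesis using gdist_adjacent[OF 3(1)] by simp
      next
        case 4
        then show ?thesis by (rule gdist_common_neighbour)
      qed
    qed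
    \<comment> \<open>Both positions now come from a single run of TP-UPDATE, which keeps them
      distinct.\<close>
    then have "j \<in> ?H i" using in_subgroup_if_close i j k_ge_2 by simp
    with eq same[of j i] U(5)[OF i] self[OF i] show "i = j" by (auto simp: inj_on_def)
  qed
  have token: "prio ?\<sigma> l = PR (?E i) l" "targ ?\<sigma> l = TA (?E i) l" if "l \<in> ?H i" for i l
    using same[OF that] by simp_all
  have changed: "tptab ?\<sigma> i \<tau> = TP (collect G N k \<sigma> i) \<tau> \<or>
      (\<exists>l \<in> ?H i. tptab ?\<sigma> i \<tau> = Some (prio ?\<sigma> l) \<and> targ ?\<sigma> l = \<tau>)" if "i \<in> N" for i \<tau>
    using U(8)[OF that, of \<tau>] token by auto
  have ge: "tptab \<sigma> j \<tau> \<le> tptab ?\<sigma> i \<tau>" if "i \<in> N" "j \<in> ?H i" for i j \<tau>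
    using order_trans[OF merged_table(2)[OF that] U(7)[OF that(1)]] by simp
  have tab: "\<exists>j \<in> ?H i. tptab \<sigma> j \<tau> = Some q" if "tptab ?\<sigma> i \<tau> = Some q" "i \<in> N"
      "\<not> (\<exists>l \<in> ?H i. q = prio ?\<sigma> l \<and> targ ?\<sigma> l = \<tau>)" for i \<tau> q
    using changed[OF that(2), of \<tau>] merged_table(1)[OF that(2), of \<sigma> \<tau>] that(1,3) by auto

  have 1: "q \<in> P" if "i \<in> N" "tptab ?\<sigma> i \<tau> = Some q" for i \<tau> q
  proof (cases "\<exists>l \<in> ?H i. q = prio ?\<sigma> l \<and> targ ?\<sigma> l = \<tau>")
    case True
    then show ?thesis using prio HN by blast
  next
    case False
    then show ?thesis using tab[OF that(2,1)] I(5) HN by blast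
  qed
  have 2: "Some (prio ?\<sigma> h) \<le> tptab ?\<sigma> h (targ ?\<sigma> h)" if "h \<in> N" for h
    using U(10)[OF that self[OF that]] by simp

  \<comment> \<open>The token now at \<open>h\<close> was held by some \<open>h0\<close> of the same
    subgroup. If it changed its target, the entry at the former one has risen above its priority;
    any earlier target was already overruled by the table of \<open>h0\<close>, which
    \<open>h\<close> now dominates.\<close>
  have old: "\<tau> = targ ?\<sigma> h \<or> Some (prio ?\<sigma> h) < tptab ?\<sigma> h \<tau>"
    if h: "h \<in> N" and j: "j \<in> N" and \<tau>: "tptab \<sigma> j \<tau> = Some (prio ?\<sigma> h)" for h j \<tau>
  proof -
    have "prio ?\<sigma> h \<in> prio \<sigma> ` ?H h" using U(3)[OF h] self[OF h] by auto
    then obtain h0 where h0: "h0 \<in> ?H h" "prio \<sigma> h0 = prio ?\<sigma> h" by auto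
    obtain l where l: "l \<in> ?H h" "PR (?E h) l = prio \<sigma> h0"
      "TA (?E h) l = targ \<sigma> h0 \<or> Some (prio \<sigma> h0) < TP (?E h) (targ \<sigma> h0)"
      using U(9)[OF h h0(1)] by blast
    have "prio ?\<sigma> l = prio ?\<sigma> h" using token[OF l(1)] l(2) h0(2) by simp
    then have "l = h" using injP HN[OF l(1)] h by (simp add: inj_on_def)
    then have now: "targ ?\<sigma> h = targ \<sigma> h0 \<or> Some (prio ?\<sigma> h) < tptab ?\<sigma> h (targ \<sigma> h0)"
      using l(3) h0(2) by simp
    have "\<tau> = targ \<sigma> h0 \<or> Some (prio ?\<sigma> h) < tptab \<sigma> h0 \<tau>"
      using I(7)[OF HN[OF h0(1)] j] \<tau> h0(2) by metis
    then show ?thesis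
      using now less_le_trans[OF _ ge[OF h h0(1)]] by metis
  qed
  have 3: "\<tau> = targ ?\<sigma> h \<or> Some (prio ?\<sigma> h) < tptab ?\<sigma> h \<tau>"
    if h: "h \<in> N" and i: "i \<in> N" and \<tau>: "tptab ?\<sigma> i \<tau> = Some (prio ?\<sigma> h)" for h i \<tau>
  proof (cases "\<exists>l \<in> ?H i. prio ?\<sigma> h = prio ?\<sigma> l \<and> targ ?\<sigma> l = \<tau>")
    case True
    then show ?thesis using injP h HN by (metis inj_onD)
  next
    case False
    then show ?thesis using tab[OF \<tau> i] old[OF h] HN by blast
  qed
  have 4: "\<tau> = \<tau>' \<or> Some q < tptab ?\<sigma> i \<tau>' \<or> Some q < tptab ?\<sigma> j \<tau>"
    if ij: "i \<in> N" "j \<in> N" and \<tau>: "tptab ?\<sigma> i \<tau> = Some q" and \<tau>': "tptab ?\<sigma> j \<tau>' = Some q"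
    for i j \<tau> \<tau>' q
  proof -
    \<comment> \<open>The holder \<open>l\<close> of the token has the same new table as
      \<open>a\<close>, so fact \<open>3\<close> for \<open>l\<close> speaks about
      \<open>a\<close>.\<close>
    have one_new: "\<rho> = \<rho>' \<or> Some q < tptab ?\<sigma> a \<rho>'"
      if ab: "a \<in> N" "b \<in> N" "tptab ?\<sigma> b \<rho>' = Some q"
        and new: "\<exists>l \<in> ?H a. q = prio ?\<sigma> l \<and> targ ?\<sigma> l = \<rho>" for a b \<rho> \<rho>'
    proof -
      obtain l where l: "l \<in> ?H a" "q = prio ?\<sigma> l" "targ ?\<sigma> l = \<rho>" using new by blast
      have "\<rho>' = \<rho> \<or> Some q < tptab ?\<sigma> l \<rho>'"
        using 3[OF HN[OF l(1)] ab(2), of \<rho>'] ab(3) l(2,3) by simp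
      then show ?thesis using same[OF l(1)] by auto
    qed
    show ?thesis
    proof (cases "(\<exists>l \<in> ?H i. q = prio ?\<sigma> l \<and> targ ?\<sigma> l = \<tau>) \<or>
        (\<exists>l \<in> ?H j. q = prio ?\<sigma> l \<and> targ ?\<sigma> l = \<tau>')")
      case True
      then show ?thesis
        using one_new[OF ij \<tau>', of \<tau>] one_new[OF ij(2,1) \<tau>, of \<tau>'] by blast
    next
      case False
      obtain a b where a: "a \<in> ?H i" "tptab \<sigma> a \<tau> = Some q" and b: "b \<in> ?H j" "tptab \<sigma> b \<tau>' = Some q"
        using tab[OF \<tau> ij(1)] tab[OF \<tau>' ij(2)] False by blast
      have "\<tau> = \<tau>' \<or> Some q < tptab \<sigma> a \<tau>' \<or> Some q < tptab \<sigma> b \<tau>"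
        using I(8)[OF HN[OF a(1)] HN[OF b(1)] a(2) b(2)] .
      then show ?thesis
        using less_le_trans[OF _ ge[OF ij(1) a(1)]] less_le_trans[OF _ ge[OF ij(2) b(1)]] by metis
    qed
  qed
  show ?thesis
    unfolding invar_def
    by (intro conjI ballI allI impI pos injV targ prio;
        (erule (1) 1 | erule 2 | erule (2) 3 | erule (3) 4))
qed

subsection \<open>Termination\<close>

text \<open>Entries grow within \<open>None\<close> and the finite set \<open>P\<close>; counting
  the priorities still above an entry turns this growth into a decreasing natural number.\<close>

definition deficit :: "('a, 'v) state \<Rightarrow> nat" where
  "deficit \<sigma> = (\<Sum>i \<in> N. \<Sum>\<tau> \<in> T. card {q \<in> P. tptab \<sigma> i \<tau> < Some q})"

definition total_energy :: "('a, 'v) state \<Rightarrow> nat" where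
  "total_energy \<sigma> = (\<Sum>i \<in> N. token_weight (gdist G (pos \<sigma> i) (targ \<sigma> i)))"

lemma deficit_step:
  assumes inv: "invar \<sigma>"
  shows "deficit (step \<sigma>) < deficit \<sigma> \<or> (\<forall>i \<in> N. \<forall>\<tau> \<in> T. tptab (step \<sigma>) i \<tau> = tptab \<sigma> i \<tau>)"
proof (rule disjCI)
  assume changed: "\<not> (\<forall>i \<in> N. \<forall>\<tau> \<in> T. tptab (step \<sigma>) i \<tau> = tptab \<sigma> i \<tau>)"
  let ?c = "\<lambda>\<sigma> i \<tau>. card {q \<in> P. tptab \<sigma> i \<tau> < Some q}"
  have ge: "tptab \<sigma> i \<tau> \<le> tptab (step \<sigma>) i \<tau>" if "i \<in> N" for i \<tau>
    using updated_table_ge[OF inv that] .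
  have subset: "{q \<in> P. tptab (step \<sigma>) i \<tau> < Some q} \<subseteq> {q \<in> P. tptab \<sigma> i \<tau> < Some q}"
    if "i \<in> N" for i \<tau>
    using ge[OF that] le_less_trans by blast
  have le: "?c (step \<sigma>) i \<tau> \<le> ?c \<sigma> i \<tau>" if "i \<in> N" for i \<tau>
    using finite_P subset[OF that] by (intro card_mono) auto
  obtain i \<tau> where i: "i \<in> N" "\<tau> \<in> T" "tptab (step \<sigma>) i \<tau> \<noteq> tptab \<sigma> i \<tau>"
    using changed by blast
  then have less: "tptab \<sigma> i \<tau> < tptab (step \<sigma>) i \<tau>" using ge[OF i(1), of \<tau>] by simp
  then obtain q where q: "tptab (step \<sigma>) i \<tau> = Some q"
    by (metis less_option_None option.exhaust)
  have "q \<in> P" using invarD(5)[OF invar_step[OF inv] i(1) q] .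
  \<comment> \<open>The new entry \<open>q\<close> itself is the priority that is lost.\<close>
  then have "{q \<in> P. tptab (step \<sigma>) i \<tau> < Some q} \<subset> {q \<in> P. tptab \<sigma> i \<tau> < Some q}"
    using subset[OF i(1), of \<tau>] less unfolding q by auto
  then have "?c (step \<sigma>) i \<tau> < ?c \<sigma> i \<tau>"
    using finite_P by (intro psubset_card_mono) auto
  then have "(\<Sum>\<tau> \<in> T. ?c (step \<sigma>) i \<tau>) < (\<Sum>\<tau> \<in> T. ?c \<sigma> i \<tau>)"
    using finite_T i le by (intro sum_strict_mono_ex1) auto
  then show "deficit (step \<sigma>) < deficit \<sigma>"
    unfolding deficit_def using finite_N i(1) le by (intro sum_strict_mono_ex1 ballI sum_mono) auto
qed

text \<open>Subgroups partition the agents and act independently. No class gains energy, and the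
  class of a misplaced agent loses some.\<close>

lemma energy_step:
  assumes inv: "invar \<sigma>" and stable: "\<forall>i \<in> N. \<forall>\<tau> \<in> T. tptab (step \<sigma>) i \<tau> = tptab \<sigma> i \<tau>"
  shows "total_energy (step \<sigma>) < total_energy \<sigma> \<or>
    (\<forall>i \<in> N. pos (step \<sigma>) i = targ (step \<sigma>) i)"
proof (rule disjCI)
  let ?H = "subgroup \<sigma>" and ?E = "updated \<sigma>"
  assume "\<not> (\<forall>i \<in> N. pos (step \<sigma>) i = targ (step \<sigma>) i)"
  then obtain i0 where i0: "i0 \<in> N" "pos (step \<sigma>) i0 \<noteq> targ (step \<sigma>) i0" by blast
  define w where "w \<sigma> i = token_weight (gdist G (pos \<sigma> i) (targ \<sigma> i))" for \<sigma> :: "('a, 'v) state" and i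
  have self: "\<And>i. i \<in> N \<Longrightarrow> i \<in> ?H i" by (rule subgroup_self)
  have fibre: "{j \<in> N. ?H j = ?H i} = ?H i" if "i \<in> N" for i
    using subgroup_subset subgroup_eq[OF invarD(1)[OF inv]] self by blast
  \<comment> \<open>Both states are split along the subgroups before the step, whatever regrouping
    follows.\<close>
  have classes: "total_energy \<rho> = (\<Sum>C \<in> ?H ` N. sum (w \<rho>) {j \<in> N. ?H j = C})" for \<rho>
    unfolding total_energy_def w_def
    using finite_N by (intro sum.group[symmetric]) auto
  have drop: "sum (w (step \<sigma>)) (?H i) < sum (w \<sigma>) (?H i) \<or>
      sum (w (step \<sigma>)) (?H i) = sum (w \<sigma>) (?H i) \<and> (\<forall>j \<in> ?H i. pos (step \<sigma>) j = targ (step \<sigma>) j)"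
    if i: "i \<in> N" for i
  proof -
    have same: "?E j = ?E i" if "j \<in> ?H i" for j using updated_eq[OF inv that] .
    \<comment> \<open>The merged table lies between the old and the new table of \<open>i\<close>,
      which agree on \<open>T\<close>.\<close>
    have tables: "TP (?E i) \<tau> = TP (collect G N k \<sigma> i) \<tau>" if "\<tau> \<in> T" for \<tau>
    proof (rule order_antisym)
      have "TP (?E i) \<tau> = tptab \<sigma> i \<tau>" using stable i that by simp
      also have "\<dots> \<le> TP (collect G N k \<sigma> i) \<tau>" using merged_table(2)[OF i self[OF i]] .
      finally show "TP (?E i) \<tau> \<le> TP (collect G N k \<sigma> i) \<tau>" .
      show "TP (collect G N k \<sigma> i) \<tau> \<le> TP (?E i) \<tau>" using updated_effect(7)[OF inv i] .
    qed
    have "sum (w (step \<sigma>)) (?H i) = energy (?E i)"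
      unfolding energy_def w_def using updated_effect(1)[OF inv i] same by (intro sum.cong) auto
    moreover have "sum (w \<sigma>) (?H i) = energy (collect G N k \<sigma> i)"
      unfolding energy_def w_def by (intro sum.cong) auto
    ultimately show ?thesis
      using updated_effect(11)[OF inv i tables] same by auto
  qed
  have "\<forall>C \<in> ?H ` N. sum (w (step \<sigma>)) {j \<in> N. ?H j = C} \<le> sum (w \<sigma>) {j \<in> N. ?H j = C}"
    using drop fibre by fastforce
  moreover have "sum (w (step \<sigma>)) {j \<in> N. ?H j = ?H i0} < sum (w \<sigma>) {j \<in> N. ?H j = ?H i0}"
    using drop[OF i0(1)] i0 self[OF i0(1)] unfolding fibre[OF i0(1)] by blast
  ultimately show "total_energy (step \<sigma>) < total_energy \<sigma>"
    unfolding classes using finite_N i0(1) by (intro sum_strict_mono_ex1) auto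
qed

lemma goals_achieved:
  assumes "invar \<sigma>"
  shows "\<exists>t. T \<subseteq> pos (tp_swap_run G N k nextVertex closest \<sigma> t) ` N"
  using assms
proof (induction \<sigma> rule: wf_induct_rule[OF wf_measures[of "[deficit, total_energy]"]])
  case (1 \<sigma>)
  note inv = \<open>invar \<sigma>\<close>
  show ?case
  proof (cases "\<forall>i \<in> N. pos (step \<sigma>) i = targ (step \<sigma>) i")
    case True
    note I = invarD[OF invar_step[OF inv]]
    have "pos (step \<sigma>) ` N \<subseteq> T" using True I(3) by auto
    moreover have "card (pos (step \<sigma>) ` N) = card T" using card_image[OF I(2)] card_T by simp
    \<comment> \<open>Only the distinctness of positions enters here: it excludes two agents with a
      common target.\<close>
    ultimately have "pos (step \<sigma>) ` N = T" using finite_T card_subset_eq by blast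
    then have "T \<subseteq> pos (tp_swap_run G N k nextVertex closest \<sigma> 1) ` N"
      by (simp add: tp_swap_run_def)
    then show ?thesis by blast
  next
    case False
    have le: "deficit (step \<sigma>) \<le> deficit \<sigma>"
      if "\<forall>i \<in> N. \<forall>\<tau> \<in> T. tptab (step \<sigma>) i \<tau> = tptab \<sigma> i \<tau>"
      using that by (simp add: deficit_def del: step_sel)
    then have "(step \<sigma>, \<sigma>) \<in> measures [deficit, total_energy]"
      using deficit_step[OF inv] energy_step[OF inv] False by (auto simp: le_less simp del: step_sel)
    then obtain t where "T \<subseteq> pos (tp_swap_run G N k nextVertex closest (step \<sigma>) t) ` N"
      using 1(1) invar_step[OF inv] by blast
    then have "T \<subseteq> pos (tp_swap_run G N k nextVertex closest \<sigma> (Suc t)) ` N"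
      by (simp add: tp_swap_run_def funpow_swap1)
    then show ?thesis by blast
  qed
qed

text \<open>Nothing is stale yet: each priority occurs only in the table of its holder, at the
  holder's target.\<close>

lemma invar_init:
  assumes "s ` N \<subseteq> verts G" "inj_on s N" "\<tau>0 ` N \<subseteq> T" "pr0 ` N = P"
  shows "invar (init_state s \<tau>0 pr0)"
proof -
  have "inj_on pr0 N"
    using assms(4) card_P finite_N by (intro eq_card_imp_inj_on) simp_all
  then show ?thesis
    using assms by (auto simp: invar_def init_state_def inj_on_def split: if_splits)
qed

end

theorem theorem1:
  fixes G :: "('v, 'e) pre_digraph"
    and N :: "'a set" and T :: "'v set" and s \<tau>0 :: "'a \<Rightarrow> 'v" and pr0 :: "'a \<Rightarrow> nat"
    and k :: nat
    and nextVertex :: "'v \<Rightarrow> 'v \<Rightarrow> 'v"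
    and closest :: "('a, 'v) tables \<Rightarrow> 'a \<Rightarrow> 'v"
  assumes "graph G" and "connected G"
    and "finite N" and "s ` N \<subseteq> verts G" and "inj_on s N"
    and "T \<subseteq> verts G" and "card T = card N"
    and "k \<ge> 2"
    and "next_vertex_rule G nextVertex"
    and "closest_target_rule G T closest"
    and "\<tau>0 ` N \<subseteq> T" and "inj_on pr0 N"
  shows "\<exists>t. \<forall>\<tau> \<in> T. \<exists>i \<in> N.
           pos (tp_swap_run G N k nextVertex closest (init_state s \<tau>0 pr0) t) i = \<tau>"
proof -
  interpret graph G by fact
  interpret tp_swap G N T "pr0 ` N" k nextVertex closest
    using assms by unfold_locales (simp_all add: card_image)
  have "invar (init_state s \<tau>0 pr0)"
    using assms by (intro invar_init) auto
  from goals_achieved[OF this] show ?thesis by (simp add: subset_iff image_iff) metis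
qed

end
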